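(* Let problems (Q) and (R) be as in the context. Assume that problem (R) has an optimal solution $v=v^*(\tau)$ with trajectory $y=y^*(\tau)$ and optimal value $\widehat J^*$, satisfying $\tau_\infty^*:=\min\{\tau\in(0,\infty):y^*(\tau)=0\}<\infty$. If in problem (Q) $$x_{f4}-x_{0,4}\ \ge\ -\frac{x_{0,1}}{M_0}\left(\frac{x_{0,1}^3}{M_0^2}\widehat J^*+M_3\tau_\infty^*\right),$$ then the optimal solution of (Q) is as follows: $$t_\infty^*=-\frac{x_{0,1}}{M_0}\tau_\infty^*\in(0,\infty),\qquad t_f^*=\frac{x_{f4}-x_{0,4}}{M_3}+\frac{x_{0,1}^4\widehat J^*}{M_0^3M_3}\ \ge\ t_\infty^*,$$ and for $t\in(0,t_f^* )$ the following hold a.e.: $$u^*(t)=-M_0\,v^*\!\left(-\tfrac{M_0}{x_{0,1}}t\right),\quad x_1^*(t)=x_{0,1}\,y_1^*\!\left(-\tfrac{M_0}{x_{0,1}}t\right),\quad x_2^*(t)=-\frac{x_{0,1}^2}{M_0}\,y_2^*\!\left(-\tfrac{M_0}{x_{0,1}}t\right),$$ $$x_3^*(t)=\frac{x_{0,1}^3}{M_0^2}\,y_3^*\!\left(-\tfrac{M_0}{x_{0,1}}t\right)+M_3,\qquad x_4^*(t)=-\frac{x_{0,1}^4}{M_0^3}\int_0^{-\frac{M_0}{x_{0,1}}t}y_3^*(\tau)\,d\tau+M_3t+x_{0,4}.$$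
   Context: Problem (Q): given $M_0,M_3\in(0,\infty)$, $x_{0,1}<0$, $x_{0,4},x_{f4}\in\mathbb R$, minimize the free terminal time $t_f$ subject to $\dot x_4=x_3$, $\dot x_3=x_2$, $\dot x_2=x_1$, $\dot x_1=u$, $x(0)=(x_{0,1},0,M_3,x_{0,4})$, $x(t_f)=(0,0,M_3,x_{f4})$, and $x_3(t)\le M_3$, $|u(t)|\le M_0$ for all $t\in[0,t_f]$ (here $x=(x_1,x_2,x_3,x_4)$). Problem (R): minimize $\widehat J=\int_0^\infty y_3(\tau)\,d\tau$ subject to $\dot y_3=y_2$, $\dot y_2=y_1$, $\dot y_1=v$, $y(0)=(1,0,0)$ (with $y=(y_1,y_2,y_3)$), $y_3(\tau)\ge0$ and $|v(\tau)|\le1$ for all $\tau\in(0,\infty)$. In (Q), $t_\infty^*$ denotes the time at which the optimal trajectory first satisfies $(x_1,x_2,x_3)=(0,0,M_3)$. *)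

theory Defs
  imports "HOL-Analysis.Analysis" "HOL-Library.Lub_Glb"
begin

lemma vector_4 [simp]:
  "(vector [a, b, c, d] :: 'a::zero ^ 4) $ 1 = a"
  "(vector [a, b, c, d] :: 'a::zero ^ 4) $ 2 = b"
  "(vector [a, b, c, d] :: 'a::zero ^ 4) $ 3 = c"
  "(vector [a, b, c, d] :: 'a::zero ^ 4) $ 4 = d"
  by (simp_all add: vector_def)

(* Caratheodory form of the differential equation F' = f on the interval S:
   F is locally absolutely continuous on S with F' = f almost everywhere.
   Lebesgue measurability of f (in particular of a control) is part of
   absolute integrability. *)
definition ode_on :: "real set \<Rightarrow> (real \<Rightarrow> real) \<Rightarrow> (real \<Rightarrow> real) \<Rightarrow> bool" where
  "ode_on S F f \<longleftrightarrow>
     (\<forall>a\<in>S. \<forall>b\<in>S. a \<le> b \<longrightarrow>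
        f absolutely_integrable_on {a..b} \<and> F b - F a = integral {a..b} f)"

definition Q_feasible ::
  "real \<Rightarrow> real \<Rightarrow> real \<Rightarrow> real \<Rightarrow> real \<Rightarrow> real \<Rightarrow> (real \<Rightarrow> real) \<Rightarrow> (real \<Rightarrow> real ^ 4) \<Rightarrow> bool" where
  "Q_feasible M0 M3 x01 x04 xf4 tf u x \<longleftrightarrow>
     0 \<le> tf \<and>
     ode_on {0..tf} (\<lambda>t. x t $ 4) (\<lambda>t. x t $ 3) \<and>
     ode_on {0..tf} (\<lambda>t. x t $ 3) (\<lambda>t. x t $ 2) \<and>
     ode_on {0..tf} (\<lambda>t. x t $ 2) (\<lambda>t. x t $ 1) \<and>
     ode_on {0..tf} (\<lambda>t. x t $ 1) u \<and>
     x 0 = vector [x01, 0, M3, x04] \<and>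
     x tf = vector [0, 0, M3, xf4] \<and>
     (\<forall>t\<in>{0..tf}. x t $ 3 \<le> M3 \<and> \<bar>u t\<bar> \<le> M0)"

definition Q_optimal ::
  "real \<Rightarrow> real \<Rightarrow> real \<Rightarrow> real \<Rightarrow> real \<Rightarrow> real \<Rightarrow> (real \<Rightarrow> real) \<Rightarrow> (real \<Rightarrow> real ^ 4) \<Rightarrow> bool" where
  "Q_optimal M0 M3 x01 x04 xf4 tf u x \<longleftrightarrow>
     Q_feasible M0 M3 x01 x04 xf4 tf u x \<and>
     (\<forall>tf' u' x'. Q_feasible M0 M3 x01 x04 xf4 tf' u' x' \<longrightarrow> tf \<le> tf')"

definition Q_at_target :: "real \<Rightarrow> real \<Rightarrow> (real \<Rightarrow> real ^ 4) \<Rightarrow> real \<Rightarrow> bool" where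
  "Q_at_target M3 tf x t \<longleftrightarrow>
     t \<in> {0..tf} \<and> x t $ 1 = 0 \<and> x t $ 2 = 0 \<and> x t $ 3 = M3"

definition R_feasible :: "(real \<Rightarrow> real) \<Rightarrow> (real \<Rightarrow> real ^ 3) \<Rightarrow> bool" where
  "R_feasible v y \<longleftrightarrow>
     ode_on {0..} (\<lambda>\<tau>. y \<tau> $ 3) (\<lambda>\<tau>. y \<tau> $ 2) \<and>
     ode_on {0..} (\<lambda>\<tau>. y \<tau> $ 2) (\<lambda>\<tau>. y \<tau> $ 1) \<and>
     ode_on {0..} (\<lambda>\<tau>. y \<tau> $ 1) v \<and>
     y 0 = vector [1, 0, 0] \<and>
     (\<forall>\<tau>\<in>{0<..}. y \<tau> $ 3 \<ge> 0 \<and> \<bar>v \<tau>\<bar> \<le> 1)"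

(* Extended-valued, because the integral may diverge along a feasible
   trajectory; the integrand is nonnegative by the state constraint. *)
definition R_cost :: "(real \<Rightarrow> real ^ 3) \<Rightarrow> ennreal" where
  "R_cost y = (\<integral>\<^sup>+\<tau>\<in>{0<..}. ennreal (y \<tau> $ 3) \<partial>lborel)"

definition R_optimal :: "(real \<Rightarrow> real) \<Rightarrow> (real \<Rightarrow> real ^ 3) \<Rightarrow> bool" where
  "R_optimal v y \<longleftrightarrow>
     R_feasible v y \<and> (\<forall>v' y'. R_feasible v' y' \<longrightarrow> R_cost y \<le> R_cost y')"

end

theory Submission
  imports Defs
begin

text \<open>Measuring time in units of \<open>- x01 / M0\<close> turns \<open>M3 - x3\<close> into a feasible third component of (R),
  extended by zero after the terminal time, and \<open>M3 * tf\<close> exceeds \<open>xf4 - x04\<close> by a positive multiple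
  of its cost. So minimizing \<open>tf\<close> in (Q) amounts to minimizing the cost in (R), and the hypothesis on
  \<open>xf4 - x04\<close> says that the optimal trajectory of (R) reaches the origin early enough to be scaled
  back. The substance is that the optimal solution of (R) is unique. If the control were not extremal
  on a non-null set where \<open>y3 > 0\<close>, one could perturb it there by a bounded function whose first three
  iterated primitives vanish at the end while the fourth does not, and lower the cost. As the problem
  is convex, the midpoint of two optimal solutions is optimal, and comparing the two on the intervals
  where the midpoint is off the state constraint shows that they coincide.\<close>

section \<open>Caratheodory solutions\<close>

text \<open>Uniqueness in (R) is needed because every optimal solution of (Q) has to be described,
  its control a.e. included, and not only the rescaled one. The cost of (R) is linear, so its
  convexity is not strict and a midpoint alone yields nothing. Strictness comes from extremality:
  two numbers in [-1, 1] whose mean is 1 or -1 are equal. Extremality is available only off the zero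
  set of the third component, which may be any closed set, possibly with accumulating contact
  points; hence the comparison works on one gap of that set at a time and never counts gaps or
  switches. On the zero set itself both nonnegative third components vanish with their midpoint. The
  perturbation uses cubics because four numbers are prescribed at the end, three state components
  and the cost, and a cubic has four coefficients. It is built directly on an arbitrary measurable
  set, so no adjoint variables enter. Optimality in (R) alone would allow an infinite cost; stopping
  at the origin gives a competitor of finite cost, which turns the cost into a real
  integral.\<close>

lemma ode_onD:
  assumes "ode_on S F f" "a \<in> S" "b \<in> S" "a \<le> b"
  shows "f absolutely_integrable_on {a..b}" "f integrable_on {a..b}" "integral {a..b} f = F b - F a"
    "(f has_integral (F b - F a)) {a..b}"
proof -
  show *: "f absolutely_integrable_on {a..b}" "integral {a..b} f = F b - F a"
    using assms unfolding ode_on_def by auto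
  show **: "f integrable_on {a..b}" using *(1) by (rule set_lebesgue_integral_eq_integral(1))
  show "(f has_integral (F b - F a)) {a..b}" using integrable_integral[OF **] *(2) by simp
qed

lemma ode_onI:
  assumes "\<And>a b. a \<in> S \<Longrightarrow> b \<in> S \<Longrightarrow> a \<le> b \<Longrightarrow> f absolutely_integrable_on {a..b}"
    and "\<And>a b. a \<in> S \<Longrightarrow> b \<in> S \<Longrightarrow> a \<le> b \<Longrightarrow> (f has_integral (F b - F a)) {a..b}"
  shows "ode_on S F f"
  unfolding ode_on_def
proof (intro ballI impI conjI)
  fix a b assume ab: "a \<in> S" "b \<in> S" "a \<le> b"
  show "f absolutely_integrable_on {a..b}" by (rule assms(1)[OF ab])
  show "F b - F a = integral {a..b} f" by (rule integral_unique[OF assms(2)[OF ab], symmetric])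
qed

lemma ode_on_subset: "ode_on S F f \<Longrightarrow> T \<subseteq> S \<Longrightarrow> ode_on T F f"
  unfolding ode_on_def by blast

text \<open>Integrals ignore null sets, so a control may be redefined on one. Since
  \<open>ode_on\<close> mentions only endpoints in \<open>S\<close>, the interval hypothesis is what
  puts \<open>{a..b}\<close> inside \<open>S\<close>.\<close>

lemma ode_on_spike:
  assumes F: "ode_on S F f" and S: "is_interval S" and N: "negligible N"
    and "\<And>t. t \<in> S \<Longrightarrow> G t = F t" and "\<And>t. t \<in> S - N \<Longrightarrow> g t = f t"
  shows "ode_on S G g"
proof (rule ode_onI)
  fix a b assume ab: "a \<in> S" "b \<in> S" "a \<le> b"
  have sub: "{a..b} \<subseteq> S" using mem_is_interval_1_I[OF S] ab by (meson atLeastAtMost_iff subsetI)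
  have eq: "g t = f t" if "t \<in> {a..b} - N" for t
    by (rule assms(5)) (use sub that in blast)
  show "g absolutely_integrable_on {a..b}"
    by (rule absolutely_integrable_spike[OF ode_onD(1)[OF F ab] N eq])
  show "(g has_integral (G b - G a)) {a..b}"
    unfolding assms(4)[OF ab(1)] assms(4)[OF ab(2)]
    by (rule has_integral_spike[OF N eq ode_onD(4)[OF F ab]])
qed

lemma ode_on_cong:
  assumes "ode_on S F f" and "is_interval S"
    and "\<And>t. t \<in> S \<Longrightarrow> G t = F t" and "\<And>t. t \<in> S \<Longrightarrow> g t = f t"
  shows "ode_on S G g"
  by (rule ode_on_spike[OF assms(1,2) negligible_empty assms(3)], assumption, rule assms(4)) simp

lemma ode_on_add:
  assumes F: "ode_on S F f" and G: "ode_on S G g"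
  shows "ode_on S (\<lambda>t. F t + G t) (\<lambda>t. f t + g t)"
proof (rule ode_onI)
  fix a b assume ab: "a \<in> S" "b \<in> S" "a \<le> b"
  show "(\<lambda>t. f t + g t) absolutely_integrable_on {a..b}"
    using ode_onD(1)[OF F ab] ode_onD(1)[OF G ab] by (rule set_integral_add)
  show "((\<lambda>t. f t + g t) has_integral (F b + G b - (F a + G a))) {a..b}"
    using has_integral_add[OF ode_onD(4)[OF F ab] ode_onD(4)[OF G ab]] by (simp add: algebra_simps)
qed

lemma ode_on_cmul:
  assumes F: "ode_on S F f"
  shows "ode_on S (\<lambda>t. c * F t) (\<lambda>t. c * f t)"
proof (rule ode_onI)
  fix a b assume ab: "a \<in> S" "b \<in> S" "a \<le> b"
  show "(\<lambda>t. c * f t) absolutely_integrable_on {a..b}"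
    using ode_onD(1)[OF F ab] by simp
  show "((\<lambda>t. c * f t) has_integral (c * F b - c * F a)) {a..b}"
    using has_integral_mult_right[OF ode_onD(4)[OF F ab], of c] by (simp add: algebra_simps)
qed

lemma ode_on_diff:
  assumes F: "ode_on S F f" and G: "ode_on S G g"
  shows "ode_on S (\<lambda>t. F t - G t) (\<lambda>t. f t - g t)"
  using ode_on_add[OF F ode_on_cmul[OF G, of "-1"]] by simp

lemma ode_on_add_const:
  "ode_on S F f \<Longrightarrow> ode_on S (\<lambda>t. F t + c) f"
  unfolding ode_on_def by simp

lemma ode_on_stretch:
  fixes c :: real
  assumes F: "ode_on S F f" and c: "0 < c" and T: "\<And>t. t \<in> T \<Longrightarrow> c * t \<in> S"
  shows "ode_on T (\<lambda>t. F (c * t)) (\<lambda>t. c * f (c * t))"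
proof (rule ode_onI)
  fix a b assume ab: "a \<in> T" "b \<in> T" "a \<le> b"
  have ab': "c * a \<in> S" "c * b \<in> S" "c * a \<le> c * b" using T ab c by auto
  have im: "(\<lambda>x. x / c) ` {c * a..c * b} = {a..b}"
    using c by (simp add: image_divide_atLeastAtMost ab)
  have st: "((\<lambda>t. g (c * t)) has_integral (I / c)) {a..b}"
    if "(g has_integral I) {c * a..c * b}" for g :: "real \<Rightarrow> real" and I
    using has_integral_stretch_real[OF that, of c] c im by simp
  have "f absolutely_integrable_on {c * a..c * b}" by (rule ode_onD(1)[OF F ab'])
  then have "f integrable_on {c * a..c * b}" "(\<lambda>x. \<bar>f x\<bar>) integrable_on {c * a..c * b}"
    unfolding absolutely_integrable_on_def by auto
  then have "(\<lambda>t. f (c * t)) integrable_on {a..b}" "(\<lambda>t. \<bar>f (c * t)\<bar>) integrable_on {a..b}"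
    using st unfolding integrable_on_def by blast+
  then have "(\<lambda>t. f (c * t)) absolutely_integrable_on {a..b}"
    unfolding absolutely_integrable_on_def by auto
  then show "(\<lambda>t. c * f (c * t)) absolutely_integrable_on {a..b}" by simp
  show "((\<lambda>t. c * f (c * t)) has_integral (F (c * b) - F (c * a))) {a..b}"
    using has_integral_mult_right[OF st[OF ode_onD(4)[OF F ab']], of c] c by simp
qed

text \<open>Freezing \<open>F\<close> outside \<open>{a..b}\<close> amounts to extending
  \<open>f\<close> by zero. This serves both to stop trajectories and to localize
  perturbations.\<close>

lemma ode_on_clamp:
  assumes F: "ode_on {a..b} F f" and ab: "a \<le> b"
  shows "ode_on S (\<lambda>t. F (max a (min b t))) (\<lambda>t. if t \<in> {a..b} then f t else 0)"
proof (rule ode_onI)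
  fix s t :: real assume st: "s \<le> t"
  let ?s = "max a (min b s)" and ?t = "max a (min b t)"
  have m: "?s \<in> {a..b}" "?t \<in> {a..b}" "?s \<le> ?t" using ab st by auto
  have f: "f absolutely_integrable_on {a..b}" using ode_onD(1)[OF F] ab by auto
  have "(\<lambda>t. if t \<in> {a..b} then f t else 0) absolutely_integrable_on UNIV"
    using f absolutely_integrable_restrict_UNIV by blast
  then show "(\<lambda>t. if t \<in> {a..b} then f t else 0) absolutely_integrable_on {s..t}"
    by (rule absolutely_integrable_on_subinterval) simp
  have *: "(f has_integral (F ?t - F ?s)) {?s..?t}" by (rule ode_onD(4)[OF F m])
  have "(f has_integral (F ?t - F ?s)) ({a..b} \<inter> {s..t})"
  proof (cases "t < a \<or> b < s")
    case True
    then have "{a..b} \<inter> {s..t} = {}" "?t = ?s" using st ab by (auto simp: max_def min_def)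
    then show ?thesis by simp
  next
    case False
    then have "{a..b} \<inter> {s..t} = {?s..?t}" using st ab by (simp add: max_def min_def)
    then show ?thesis using * by (simp only:)
  qed
  then show "((\<lambda>t. if t \<in> {a..b} then f t else 0) has_integral (F ?t - F ?s)) {s..t}"
    by (subst has_integral_restrict_Int)
qed

lemma ode_on_indefinite:
  assumes "f absolutely_integrable_on {a..b}"
  shows "ode_on {a..b} (\<lambda>t. integral {a..t} f) f"
  unfolding ode_on_def
proof (intro ballI impI conjI)
  fix s t assume st: "s \<in> {a..b}" "t \<in> {a..b}" "s \<le> t"
  then show "f absolutely_integrable_on {s..t}"
    by (intro absolutely_integrable_on_subinterval[OF assms]) auto
  have "f integrable_on {a..t}"
    using st by (intro set_lebesgue_integral_eq_integral(1) absolutely_integrable_on_subinterval[OF assms]) auto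
  then show "integral {a..t} f - integral {a..s} f = integral {s..t} f"
    using Henstock_Kurzweil_Integration.integral_combine[of a s t f] st by auto
qed

lemma ode_on_continuous_on:
  assumes F: "ode_on {a..b} F f"
  shows "continuous_on {a..b} F"
proof (cases "a \<le> b")
  case True
  have "continuous_on {a..b} (\<lambda>t. F a + integral {a..t} f)"
    using ode_onD(2)[OF F] True
    by (intro continuous_intros indefinite_integral_continuous_1) auto
  moreover have "F a + integral {a..t} f = F t" if "t \<in> {a..b}" for t
    using ode_onD(3)[OF F, of a t] that by auto
  ultimately show ?thesis by (rule continuous_on_eq)
qed auto

lemma ode_on_has_real_derivative:
  assumes F: "ode_on {a..b} F f" and f: "continuous_on {a..b} f" and t: "t \<in> {a..b}"
  shows "(F has_real_derivative f t) (at t within {a..b})"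
proof -
  have *: "((\<lambda>t. F a + integral {a..t} f) has_real_derivative f t) (at t within {a..b})"
    using integral_has_real_derivative[OF f t] by (auto intro!: derivative_eq_intros)
  have "F s = F a + integral {a..s} f" if s: "s \<in> {a..b}" for s
  proof -
    have "a \<in> {a..b}" "a \<le> s" using s by auto
    from ode_onD(3)[OF F this(1) s this(2)] show ?thesis by linarith
  qed
  from has_derivative_transform[OF t this *[unfolded has_field_derivative_def]] show ?thesis
    unfolding has_field_derivative_def .
qed

text \<open>Lebesgue's differentiation theorem: an integrable function is determined a.e. by its
  integrals over intervals.\<close>
lemma ode_on_unique_negligible:
  assumes F: "ode_on {a..b} F f" and G: "ode_on {a..b} F g"
  shows "negligible {t \<in> {a..b}. f t \<noteq> g t}"
proof (cases "a \<le> b")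
  case True
  \<comment> \<open>The differentiation theorem wants integrability on every box of the line;
    extension by zero provides it and keeps all integrals equal to 0.\<close>
  define h where "h t = (if t \<in> {a..b} then f t - g t else 0)" for t
  have "ode_on {a..b} (\<lambda>t. 0) (\<lambda>t. f t - g t)" using ode_on_diff[OF F G] by simp
  from ode_on_clamp[OF this True] have h: "ode_on UNIV (\<lambda>t. 0) h" unfolding h_def .
  have int: "(h has_integral 0) (cbox s t)" for s t
  proof (cases "s \<le> t")
    case True
    then show ?thesis using ode_onD(4)[OF h, of s t] by simp
  qed simp
  have int_h: "h integrable_on cbox s t" "integral (cbox s t) h = 0" for s t
    using has_integral_integrable[OF int] integral_unique[OF int] by simp_all
  obtain N where N: "negligible N"
    and k: "\<And>x e. \<lbrakk>x \<notin> N; 0 < e\<rbrakk> \<Longrightarrow> \<exists>d>0. \<forall>r. 0 < r \<and> r < d \<longrightarrow>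
                  norm (integral (cbox x (x + r *\<^sub>R One)) h /\<^sub>R r ^ DIM(real) - h x) < e"
    using integrable_ccontinuous_explicit[of h] int_h(1) by blast
  have "h x = 0" if x: "x \<notin> N" for x
  proof (rule ccontr)
    assume "h x \<noteq> 0"
    then obtain d where "d > 0" "\<forall>r. 0 < r \<and> r < d \<longrightarrow>
      norm (integral (cbox x (x + r *\<^sub>R One)) h /\<^sub>R r ^ DIM(real) - h x) < \<bar>h x\<bar>"
      using k[OF x, of "\<bar>h x\<bar>"] by auto
    \<comment> \<open>All averages of \<open>h\<close> vanish, so the estimate with tolerance
      \<open>\<bar>h x\<bar>\<close> reads \<open>\<bar>h x\<bar> < \<bar>h x\<bar>\<close>.\<close>
    from this(2)[rule_format, of "d/2"] this(1) show False
      using int_h(2)[of x "x + d / 2"] by simp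
  qed
  then have "{t \<in> {a..b}. f t \<noteq> g t} \<subseteq> N" unfolding h_def by (smt (verit, best) mem_Collect_eq subsetI)
  then show ?thesis by (rule negligible_subset[OF N])
qed auto

text \<open>The difference quotients are at most \<open>K * \<bar>t - s\<bar>\<close>, so the
  derivative is 0 at every point, with no exceptional null set.\<close>

lemma quadratic_increment_imp_const:
  fixes D :: "real \<Rightarrow> real"
  assumes K: "\<And>s t. s \<in> {a..b} \<Longrightarrow> t \<in> {a..b} \<Longrightarrow> s \<le> t \<Longrightarrow> \<bar>D t - D s\<bar> \<le> K * (t - s)\<^sup>2"
    and "a \<le> b"
  shows "D b = D a"
proof -
  have K': "\<bar>D t - D s\<bar> \<le> K * (t - s)\<^sup>2" if "s \<in> {a..b}" "t \<in> {a..b}" for s t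
  proof (cases "s \<le> t")
    case False
    then show ?thesis
      using K[of t s] that by (simp add: power2_commute[of t] abs_minus_commute[of "D t"])
  qed (use K that in blast)
  have "(D has_field_derivative 0) (at s within {a..b})" if s: "s \<in> {a..b}" for s
    unfolding has_field_derivative_iff
  proof (rule Lim_null_comparison)
    show "\<forall>\<^sub>F t in at s within {a..b}. norm ((D t - D s) / (t - s)) \<le> K * \<bar>t - s\<bar>"
      unfolding eventually_at_filter
    proof (rule always_eventually, intro allI impI)
      fix t assume "t \<noteq> s" "t \<in> {a..b}"
      then show "norm ((D t - D s) / (t - s)) \<le> K * \<bar>t - s\<bar>"
        using K'[OF s, of t] by (simp add: pos_divide_le_eq power2_eq_square mult.assoc)
    qed
    show "((\<lambda>t. K * \<bar>t - s\<bar>) \<longlongrightarrow> 0) (at s within {a..b})"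
      by (rule tendsto_eq_intros refl | simp)+
  qed
  then show ?thesis
    using has_field_derivative_zero_constant[of "{a..b}" D] \<open>a \<le> b\<close> by force
qed

lemma continuous_on_Icc_bounded:
  fixes g :: "real \<Rightarrow> real"
  assumes "continuous_on {a..b} g"
  obtains C where "0 \<le> C" "\<And>t. t \<in> {a..b} \<Longrightarrow> \<bar>g t\<bar> \<le> C"
proof -
  have "bounded (g ` {a..b})"
    using compact_continuous_image[OF assms] compact_imp_bounded by auto
  then obtain C where "C > 0" "\<And>x. x \<in> g ` {a..b} \<Longrightarrow> norm x \<le> C"
    unfolding bounded_pos by blast
  then show ?thesis using that[of C] by auto
qed

lemma has_integral_abs_le:
  fixes f :: "real \<Rightarrow> real"
  assumes "(f has_integral i) {s..t}" and "\<And>r. r \<in> {s..t} \<Longrightarrow> \<bar>f r\<bar> \<le> K" and "0 \<le> K" "s \<le> t"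
  shows "\<bar>i\<bar> \<le> K * (t - s)"
  using has_integral_bound[of K f i s t] assms by simp

text \<open>As \<open>F\<close> is merely Lipschitz, the classical rule does not apply; instead, the defect of the
  identity on \<open>{s..t}\<close> is quadratic in \<open>t - s\<close>.\<close>
lemma ode_on_by_parts:
  assumes F: "ode_on {a..b} F f" and B: "\<And>t. t \<in> {a..b} \<Longrightarrow> \<bar>f t\<bar> \<le> B"
    and G: "\<And>t. t \<in> {a..b} \<Longrightarrow> (G has_real_derivative g t) (at t within {a..b})"
    and g: "continuous_on {a..b} g" and ab: "a \<le> b"
  shows "((\<lambda>t. f t * G t + F t * g t) has_integral (F b * G b - F a * G a)) {a..b}"
proof -
  have B0: "0 \<le> B" using B[of a] ab by force
  have odeG: "ode_on {a..b} G g"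
  proof (rule ode_onI)
    fix s t assume st: "s \<in> {a..b}" "t \<in> {a..b}" "s \<le> t"
    then have sub: "{s..t} \<subseteq> {a..b}" by auto
    show "g absolutely_integrable_on {s..t}"
      by (intro absolutely_integrable_continuous_real continuous_on_subset[OF g sub])
    show "(g has_integral (G t - G s)) {s..t}"
      using st sub G by (intro fundamental_theorem_of_calculus)
        (auto simp: has_real_derivative_iff_has_vector_derivative[symmetric] intro!: DERIV_subset[OF _ sub])
  qed
  have contF: "continuous_on {a..b} F" and contG: "continuous_on {a..b} G"
    using ode_on_continuous_on F odeG by blast+
  obtain C where C: "0 \<le> C" "\<And>t. t \<in> {a..b} \<Longrightarrow> \<bar>g t\<bar> \<le> C"
    using continuous_on_Icc_bounded[OF g] by metis
  have lip: "\<bar>H t - H s\<bar> \<le> K * (t - s)"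
    if "ode_on {a..b} H h" "\<And>t. t \<in> {a..b} \<Longrightarrow> \<bar>h t\<bar> \<le> K" "0 \<le> K" "s \<in> {a..b}" "t \<in> {a..b}" "s \<le> t"
    for H h :: "real \<Rightarrow> real" and K s t
    by (rule has_integral_abs_le[OF ode_onD(4)[OF that(1,4,5,6)]]) (use that in auto)
  have intf: "f absolutely_integrable_on {a..b}" using ode_onD(1)[OF F] ab by auto
  obtain M where "0 \<le> M" and M: "\<And>t. t \<in> {a..b} \<Longrightarrow> \<bar>G t\<bar> \<le> M"
    using continuous_on_Icc_bounded[OF contG] by metis
  have intfG: "(\<lambda>t. f t * G t) absolutely_integrable_on {a..b}"
  proof (rule measurable_bounded_by_integrable_imp_absolutely_integrable)
    show "(\<lambda>t. f t * G t) \<in> borel_measurable (lebesgue_on {a..b})"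
      by (intro borel_measurable_times absolutely_integrable_imp_borel_measurable[OF intf]
          continuous_imp_measurable_on_sets_lebesgue[OF contG]) auto
    show "(\<lambda>t. B * M) integrable_on {a..b}" by auto
    show "norm (f t * G t) \<le> B * M" if "t \<in> {a..b}" for t
      using mult_mono[OF B[OF that] M[OF that]] B0 by (simp add: abs_mult)
  qed auto
  have ode: "ode_on {a..b} (\<lambda>t. integral {a..t} (\<lambda>t. f t * G t + F t * g t)) (\<lambda>t. f t * G t + F t * g t)"
    by (intro ode_on_indefinite set_integral_add intfG absolutely_integrable_continuous_real continuous_intros contF g)
  define P where "P t = integral {a..t} (\<lambda>t. f t * G t + F t * g t)" for t
  note ode = ode[folded P_def]
  define D where "D t = F t * G t - P t" for t
  have "D b = D a"
  proof (rule quadratic_increment_imp_const[OF _ ab])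
    fix s t assume st: "s \<in> {a..b}" "t \<in> {a..b}" "s \<le> t"
    have sub: "r \<in> {a..b}" if "r \<in> {s..t}" for r using st that by auto
    \<comment> \<open>The increment of the product splits exactly as
      \<open>(F t - F s) * G t + F s * (G t - G s)\<close>; accordingly \<open>G\<close> is frozen
      at the right end and \<open>F\<close> at the left end of \<open>{s..t}\<close>.\<close>
    have "((\<lambda>r. (f r * G t + F s * g r) - (f r * G r + F r * g r)) has_integral
        ((F t - F s) * G t + F s * (G t - G s)) - (P t - P s)) {s..t}"
      by (intro has_integral_diff has_integral_add has_integral_mult_left has_integral_mult_right
          ode_onD(4)[OF F] ode_onD(4)[OF odeG] ode_onD(4)[OF ode] st)
    moreover have "((F t - F s) * G t + F s * (G t - G s)) - (P t - P s) = D t - D s"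
      by (simp add: D_def algebra_simps)
    ultimately have hi: "((\<lambda>r. (f r * G t + F s * g r) - (f r * G r + F r * g r)) has_integral (D t - D s)) {s..t}"
      by simp
    have "\<bar>D t - D s\<bar> \<le> (2 * B * C * (t - s)) * (t - s)"
    proof (rule has_integral_abs_le[OF hi])
      show "0 \<le> 2 * B * C * (t - s)" using B0 C st by simp
      show "s \<le> t" by (rule st(3))
      fix r assume r: "r \<in> {s..t}"
      have "\<bar>(f r * G t + F s * g r) - (f r * G r + F r * g r)\<bar> = \<bar>f r * (G t - G r) - (F r - F s) * g r\<bar>"
        by (simp add: algebra_simps)
      also have "\<dots> \<le> \<bar>f r\<bar> * \<bar>G t - G r\<bar> + \<bar>F r - F s\<bar> * \<bar>g r\<bar>"
        using abs_triangle_ineq4[of "f r * (G t - G r)" "(F r - F s) * g r"] by (simp add: abs_mult)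
      also have "\<dots> \<le> B * (C * (t - s)) + (B * (t - s)) * C"
      proof (intro add_mono mult_mono)
        have "\<bar>G t - G r\<bar> \<le> C * (t - r)" using r st sub by (intro lip[OF odeG C(2,1)]) auto
        also have "\<dots> \<le> C * (t - s)" using r C by (intro mult_left_mono) auto
        finally show "\<bar>G t - G r\<bar> \<le> C * (t - s)" .
        have "\<bar>F r - F s\<bar> \<le> B * (r - s)" using r st sub by (intro lip[OF F B B0]) auto
        also have "\<dots> \<le> B * (t - s)" using r B0 by (intro mult_left_mono) auto
        finally show "\<bar>F r - F s\<bar> \<le> B * (t - s)" .
      qed (use B[OF sub[OF r]] C(2)[OF sub[OF r]] B0 C st in auto)
      finally show "\<bar>(f r * G t + F s * g r) - (f r * G r + F r * g r)\<bar> \<le> 2 * B * C * (t - s)"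
        by (simp add: algebra_simps)
    qed
    then show "\<bar>D t - D s\<bar> \<le> (2 * B * C) * (t - s)\<^sup>2"
      by (simp add: power2_eq_square mult.assoc)
  qed
  moreover have "P a = 0" by (simp add: P_def)
  ultimately have "P b - P a = F b * G b - F a * G a" by (simp add: D_def)
  then show ?thesis using ode_onD(4)[OF ode, of a b] ab by simp
qed

section \<open>Perturbations with prescribed moments\<close>

text \<open>Nonnegativity squeezes the integral over each subinterval between 0 and the total 0, so
  \<open>f\<close> shares its primitive with the zero function.\<close>

lemma negligible_of_has_integral_0:
  fixes f :: "real \<Rightarrow> real"
  assumes f: "(f has_integral 0) {a..b}" and nonneg: "\<And>t. t \<in> {a..b} \<Longrightarrow> 0 \<le> f t"
  shows "negligible {t \<in> {a..b}. f t \<noteq> 0}"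
proof -
  have abs: "f absolutely_integrable_on {a..b}"
    using f nonneg absolutely_integrable_on_iff_nonneg[of "{a..b}" f] by blast
  have "ode_on {a..b} (\<lambda>t. 0) f"
  proof (rule ode_onI)
    fix s t assume st: "s \<in> {a..b}" "t \<in> {a..b}" "s \<le> t"
    then have sub: "{s..t} \<subseteq> {a..b}" by auto
    show abs': "f absolutely_integrable_on {s..t}" by (rule absolutely_integrable_on_subinterval[OF abs sub])
    then have int: "f integrable_on {s..t}" by (rule set_lebesgue_integral_eq_integral(1))
    have "integral {s..t} f \<le> integral {a..b} f"
      using f sub nonneg by (intro integral_subset_le int) auto
    moreover have "0 \<le> integral {s..t} f"
      using sub nonneg by (intro Henstock_Kurzweil_Integration.integral_nonneg int) auto
    ultimately show "(f has_integral (0 - 0)) {s..t}"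
      using integrable_integral[OF int] integral_unique[OF f] by simp
  qed
  moreover have "ode_on {a..b} (\<lambda>t. 0) (\<lambda>t. 0::real)"
    by (auto simp: ode_on_def)
  ultimately show ?thesis by (rule ode_on_unique_negligible)
qed

definition primitive :: "real \<Rightarrow> (real \<Rightarrow> real) \<Rightarrow> real \<Rightarrow> real" where
  "primitive a f t = integral {a..t} f"

lemma ode_on_primitive:
  "f absolutely_integrable_on {a..b} \<Longrightarrow> ode_on {a..b} (primitive a f) f"
  using ode_on_indefinite unfolding primitive_def .

lemma primitive_linear:
  assumes "f absolutely_integrable_on {a..b}" "g absolutely_integrable_on {a..b}" "t \<in> {a..b}"
    and h: "\<And>s. s \<in> {a..b} \<Longrightarrow> h s = r * f s + g s"
  shows "primitive a h t = r * primitive a f t + primitive a g t"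
proof -
  have sub: "{a..t} \<subseteq> {a..b}" using assms(3) by auto
  have int: "f integrable_on {a..t}" "g integrable_on {a..t}"
    using absolutely_integrable_on_subinterval[OF assms(1) sub] absolutely_integrable_on_subinterval[OF assms(2) sub]
    by (simp_all add: set_lebesgue_integral_eq_integral(1))
  have "((\<lambda>s. r * f s + g s) has_integral (r * primitive a f t + primitive a g t)) {a..t}"
    unfolding primitive_def
    by (intro has_integral_add has_integral_mult_right integrable_integral int)
  then have "(h has_integral (r * primitive a f t + primitive a g t)) {a..t}"
    by (rule has_integral_eq[rotated]) (use h sub in auto)
  then show ?thesis unfolding primitive_def by (rule integral_unique)
qed

lemma primitive_continuous:
  assumes "f absolutely_integrable_on {a..b}"
  shows "continuous_on {a..b} (primitive a f)" and "primitive a f absolutely_integrable_on {a..b}"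
proof -
  show *: "continuous_on {a..b} (primitive a f)"
    by (rule ode_on_continuous_on[OF ode_on_primitive[OF assms]])
  from * show "primitive a f absolutely_integrable_on {a..b}"
    by (rule absolutely_integrable_continuous_real)
qed

text \<open>One step of moving derivatives from a polynomial onto a chain of iterated primitives;
  the boundary terms drop out because \<open>F\<close> vanishes at both ends.\<close>

lemma poly_by_parts:
  assumes F: "ode_on {a..b} F f" and B: "\<And>t. t \<in> {a..b} \<Longrightarrow> \<bar>f t\<bar> \<le> B" and ab: "a \<le> b"
    and "F a = 0" "F b = 0" and int: "((\<lambda>t. F t * poly (pderiv p) t) has_integral I) {a..b}"
  shows "((\<lambda>t. f t * poly p t) has_integral - I) {a..b}"
proof -
  have "((\<lambda>t. f t * poly p t + F t * poly (pderiv p) t) has_integral (F b * poly p b - F a * poly p a)) {a..b}"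
  proof (rule ode_on_by_parts[OF F B _ _ ab])
    show "(poly p has_real_derivative poly (pderiv p) t) (at t within {a..b})" for t
      by (rule DERIV_subset[OF poly_DERIV]) simp
    show "continuous_on {a..b} (poly (pderiv p))" by (intro continuous_on_poly continuous_on_id)
  qed
  from has_integral_diff[OF this int] show ?thesis using assms(4,5) by simp
qed

text \<open>A perturbation of the control supported on a prescribed non-null set that leaves the state
  unchanged at the endpoint and changes only the cost. The endpoint map from cubic polynomials on
  the support is injective: if all four iterated primitives of a cubic vanish at the endpoint, then
  integrating by parts against the cubic itself shows that it is orthogonal to itself.\<close>
lemma exists_moment_perturbation:
  assumes E: "E \<in> sets lebesgue" "E \<subseteq> {a..b}" "\<not> negligible E" and ab: "a \<le> b"
  obtains h B H1 H2 H3 H4 where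
    "\<And>t. \<bar>h t\<bar> \<le> B" "\<And>t. t \<notin> E \<Longrightarrow> h t = 0"
    "ode_on {a..b} H1 h" "ode_on {a..b} H2 H1" "ode_on {a..b} H3 H2" "ode_on {a..b} H4 H3"
    "H1 a = 0" "H2 a = 0" "H3 a = 0" "H4 a = 0" "H1 b = 0" "H2 b = 0" "H3 b = 0" "H4 b = 1"
proof -
  define p where "p c = [:c$1, c$2, c$3, c$4:]" for c :: "real ^ 4"
  define h where "h c t = (if t \<in> E then poly (p c) t else 0)" for c t
  define K1 where "K1 c = primitive a (h c)" for c
  define K2 where "K2 c = primitive a (K1 c)" for c
  define K3 where "K3 c = primitive a (K2 c)" for c
  define K4 where "K4 c = primitive a (K3 c)" for c
  have bound: "\<exists>B. \<forall>t. \<bar>h c t\<bar> \<le> B" for c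
  proof -
    obtain C where "0 \<le> C" "\<And>t. t \<in> {a..b} \<Longrightarrow> \<bar>poly (p c) t\<bar> \<le> C"
      using continuous_on_Icc_bounded[of a b "poly (p c)"] continuous_on_poly[OF continuous_on_id] by blast
    then have "\<bar>h c t\<bar> \<le> C" for t using E(2) by (auto simp: h_def)
    then show ?thesis by blast
  qed
  have h_int: "h c absolutely_integrable_on {a..b}" for c
  proof -
    have "poly (p c) absolutely_integrable_on {a..b}"
      by (intro absolutely_integrable_continuous_real continuous_on_poly continuous_on_id)
    then have "set_integrable lebesgue E (poly (p c))"
      using E by (auto intro: set_integrable_subset)
    then have "h c absolutely_integrable_on UNIV"
      unfolding h_def using absolutely_integrable_restrict_UNIV by blast
    then show ?thesis by (rule absolutely_integrable_on_subinterval) simp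
  qed
  have K1_int: "K1 c absolutely_integrable_on {a..b}" for c
    unfolding K1_def by (rule primitive_continuous(2)[OF h_int])
  have K2_int: "K2 c absolutely_integrable_on {a..b}" for c
    unfolding K2_def by (rule primitive_continuous(2)[OF K1_int])
  have K3_int: "K3 c absolutely_integrable_on {a..b}" for c
    unfolding K3_def by (rule primitive_continuous(2)[OF K2_int])
  have ode1: "ode_on {a..b} (K1 c) (h c)" for c unfolding K1_def by (rule ode_on_primitive[OF h_int])
  have ode2: "ode_on {a..b} (K2 c) (K1 c)" for c unfolding K2_def by (rule ode_on_primitive[OF K1_int])
  have ode3: "ode_on {a..b} (K3 c) (K2 c)" for c unfolding K3_def by (rule ode_on_primitive[OF K2_int])
  have ode4: "ode_on {a..b} (K4 c) (K3 c)" for c unfolding K4_def by (rule ode_on_primitive[OF K3_int])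
  have zero: "K1 c a = 0" "K2 c a = 0" "K3 c a = 0" "K4 c a = 0" for c
    unfolding K1_def K2_def K3_def K4_def primitive_def by simp_all
  \<comment> \<open>The single form \<open>r *\<^sub>R c + d\<close> covers additivity and
    homogeneity at once, so linearity passes up the four primitives one line at a time.\<close>
  have lin0: "h (r *\<^sub>R c + d) t = r * h c t + h d t" for r c d t
    by (simp add: h_def p_def algebra_simps)
  have lin1: "K1 (r *\<^sub>R c + d) t = r * K1 c t + K1 d t" if "t \<in> {a..b}" for r c d t
    unfolding K1_def by (rule primitive_linear[OF h_int h_int that lin0])
  have lin2: "K2 (r *\<^sub>R c + d) t = r * K2 c t + K2 d t" if "t \<in> {a..b}" for r c d t
    unfolding K2_def by (rule primitive_linear[OF K1_int K1_int that lin1])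
  have lin3: "K3 (r *\<^sub>R c + d) t = r * K3 c t + K3 d t" if "t \<in> {a..b}" for r c d t
    unfolding K3_def by (rule primitive_linear[OF K2_int K2_int that lin2])
  have lin4: "K4 (r *\<^sub>R c + d) t = r * K4 c t + K4 d t" if "t \<in> {a..b}" for r c d t
    unfolding K4_def by (rule primitive_linear[OF K3_int K3_int that lin3])
  define L :: "real ^ 4 \<Rightarrow> real ^ 4" where "L c = vector [K1 c b, K2 c b, K3 c b, K4 c b]" for c
  have b: "b \<in> {a..b}" using ab by simp
  have L_lin: "L (r *\<^sub>R c + d) = r *\<^sub>R L c + L d" for r c d
    unfolding vec_eq_iff forall_4 L_def using b by (simp add: lin1 lin2 lin3 lin4)
  have L0: "L 0 = 0" using L_lin[of "-1" 0 0] by simp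
  have linL: "linear L"
    using L_lin[of 1] L_lin[of _ _ 0] L0 by (intro linearI) auto
  have "c = 0" if "L c = 0" for c
  proof -
    have K: "K1 c b = 0" "K2 c b = 0" "K3 c b = 0" "K4 c b = 0"
      using that unfolding vec_eq_iff forall_4 L_def by simp_all
    let ?p = "p c"
    obtain B0 where B0: "\<And>t. \<bar>h c t\<bar> \<le> B0" using bound by blast
    obtain B1 where B1: "\<And>t. t \<in> {a..b} \<Longrightarrow> \<bar>K1 c t\<bar> \<le> B1"
      using continuous_on_Icc_bounded[OF ode_on_continuous_on[OF ode1]] by metis
    obtain B2 where B2: "\<And>t. t \<in> {a..b} \<Longrightarrow> \<bar>K2 c t\<bar> \<le> B2"
      using continuous_on_Icc_bounded[OF ode_on_continuous_on[OF ode2]] by metis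
    obtain B3 where B3: "\<And>t. t \<in> {a..b} \<Longrightarrow> \<bar>K3 c t\<bar> \<le> B3"
      using continuous_on_Icc_bounded[OF ode_on_continuous_on[OF ode3]] by metis
    \<comment> \<open>The descent starts at \<open>K4\<close>, where the fourth derivative of a
      cubic is 0, and ends with \<open>h c\<close> tested against the cubic itself.\<close>
    have "pderiv (pderiv (pderiv (pderiv ?p))) = 0"
      by (simp add: p_def pderiv_pCons)
    then have "((\<lambda>t. K4 c t * poly (pderiv (pderiv (pderiv (pderiv ?p)))) t) has_integral 0) {a..b}"
      by simp
    from poly_by_parts[OF ode4 B3 ab zero(4) K(4) this]
    have "((\<lambda>t. K3 c t * poly (pderiv (pderiv (pderiv ?p))) t) has_integral 0) {a..b}" by simp
    from poly_by_parts[OF ode3 B2 ab zero(3) K(3) this]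
    have "((\<lambda>t. K2 c t * poly (pderiv (pderiv ?p)) t) has_integral 0) {a..b}" by simp
    from poly_by_parts[OF ode2 B1 ab zero(2) K(2) this]
    have "((\<lambda>t. K1 c t * poly (pderiv ?p) t) has_integral 0) {a..b}" by simp
    from poly_by_parts[OF ode1 B0 ab zero(1) K(1) this]
    have "((\<lambda>t. h c t * poly ?p t) has_integral 0) {a..b}" by simp
    from negligible_of_has_integral_0[OF this]
    \<comment> \<open>On \<open>E\<close> the product \<open>h c t * poly ?p t\<close> is a square,
      and off \<open>E\<close> it is 0; so the cubic vanishes a.e. on the non-null set
      \<open>E\<close>, which is more than finitely many roots allow.\<close>
    have neg: "negligible {t \<in> {a..b}. h c t * poly ?p t \<noteq> 0}" by (simp add: h_def)
    have "?p = 0"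
    proof (rule ccontr)
      assume "?p \<noteq> 0"
      then have "negligible {t. poly ?p t = 0}" by (intro negligible_finite poly_roots_finite)
      with neg have "negligible ({t \<in> {a..b}. h c t * poly ?p t \<noteq> 0} \<union> {t. poly ?p t = 0})"
        by (rule negligible_Un)
      moreover have "E \<subseteq> {t \<in> {a..b}. h c t * poly ?p t \<noteq> 0} \<union> {t. poly ?p t = 0}"
        using E(2) by (auto simp: h_def)
      ultimately show False using E(3) negligible_subset by blast
    qed
    then show "c = 0" unfolding vec_eq_iff forall_4 p_def by simp
  qed
  then have "surj L"
    using linear_injective_imp_surjective[OF linL] linear_injective_0[OF linL] by blast
  then obtain c where "L c = vector [0, 0, 0, 1]" by (metis surjD)
  then have "K1 c b = 0" "K2 c b = 0" "K3 c b = 0" "K4 c b = 1"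
    unfolding vec_eq_iff forall_4 L_def by simp_all
  moreover obtain B where "\<And>t. \<bar>h c t\<bar> \<le> B" using bound by blast
  ultimately show thesis
    using that[of "h c" B "K1 c" "K2 c" "K3 c" "K4 c"] ode1 ode2 ode3 ode4 zero by (simp add: h_def)
qed

section \<open>Problem (R)\<close>

text \<open>If \<open>f\<close> vanishes where it gets frozen, clamping it agrees with extending it
  by zero, so consecutive equations can be clamped together. The left condition is void when
  \<open>S\<close> starts at \<open>a\<close>; this admits the initial value 1 of the first
  component.\<close>

lemma ode_on_clamp_chain:
  assumes F: "ode_on {a..b} F f" and ab: "a \<le> b" and S: "is_interval S"
    and "\<And>t. t \<in> S \<Longrightarrow> t < a \<Longrightarrow> f a = 0" and "f b = 0"
  shows "ode_on S (\<lambda>t. F (max a (min b t))) (\<lambda>t. f (max a (min b t)))"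
proof (rule ode_on_cong[OF ode_on_clamp[OF F ab] S refl])
  fix t assume t: "t \<in> S"
  consider "t < a" | "t \<in> {a..b}" | "b < t" by fastforce
  then show "f (max a (min b t)) = (if t \<in> {a..b} then f t else 0)"
  proof cases
    case 1
    then show ?thesis using assms(4)[OF t] ab by simp
  next
    case 3
    then show ?thesis using assms(5) ab by simp
  qed simp
qed

lemma ode_on_continuous_on_atLeast:
  assumes F: "ode_on {a..} F f"
  shows "continuous_on {a<..} F"
proof -
  have "{a<..} = (\<Union>n. {a<..<a + real n})"
  proof (intro equalityI subsetI)
    fix x assume "x \<in> {a<..}"
    moreover obtain n where "x - a < real n" using reals_Archimedean2 by blast
    ultimately show "x \<in> (\<Union>n. {a<..<a + real n})" by (auto intro!: exI[of _ n])
  qed auto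
  moreover have "continuous_on (\<Union>n. {a<..<a + real n}) F"
  proof (rule continuous_on_open_UN)
    fix n
    have "ode_on {a..a + real n} F f" by (rule ode_on_subset[OF F]) auto
    then show "continuous_on {a<..<a + real n} F"
      by (rule continuous_on_subset[OF ode_on_continuous_on]) auto
  qed auto
  ultimately show ?thesis by simp
qed

lemma ode_on_zero_imp_zero:
  assumes F: "ode_on {a..b} F f" and f: "continuous_on {a..b} f" and "a < b"
    and zero: "\<And>t. t \<in> {a..b} \<Longrightarrow> F t = 0" and t: "t \<in> {a..b}"
  shows "f t = 0"
proof -
  have "(F has_vector_derivative f t) (at t within {a..b})"
    using ode_on_has_real_derivative[OF F f t] by (simp add: has_real_derivative_iff_has_vector_derivative)
  moreover have "(F has_vector_derivative 0) (at t within {a..b})"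
    by (rule has_vector_derivative_transform[OF t zero has_vector_derivative_const])
  ultimately show ?thesis
    using vector_derivative_unique_within_closed_interval[where a=a and b=b and x=t and f=F] \<open>a < b\<close> t by auto
qed

lemma ode_on_const:
  assumes F: "ode_on {a..b} F f" and N: "negligible {t \<in> {a..b}. f t \<noteq> k}" and t: "t \<in> {a..b}"
  shows "F t = F a + k * (t - a)"
proof -
  have a: "a \<in> {a..b}" "a \<le> t" using t by auto
  have "((\<lambda>_. k) has_integral (k * (t - a))) {a..t}"
    using has_integral_const_real[of k a t] a by (simp add: mult.commute)
  then have "(f has_integral (k * (t - a))) {a..t}"
    by (rule has_integral_spike[OF N, rotated]) (use t in auto)
  from has_integral_unique[OF this ode_onD(4)[OF F a(1) t a(2)]] show ?thesis by simp
qed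

section \<open>Feasible trajectories of (R) and their cost\<close>

lemma R_feasibleD:
  assumes "R_feasible v y"
  shows "ode_on {0..} (\<lambda>t. y t $ 3) (\<lambda>t. y t $ 2)" "ode_on {0..} (\<lambda>t. y t $ 2) (\<lambda>t. y t $ 1)"
    "ode_on {0..} (\<lambda>t. y t $ 1) v" "y 0 $ 1 = 1" "y 0 $ 2 = 0" "y 0 $ 3 = 0"
    "\<And>t. 0 < t \<Longrightarrow> 0 \<le> y t $ 3" "\<And>t. 0 < t \<Longrightarrow> \<bar>v t\<bar> \<le> 1"
  using assms unfolding R_feasible_def by simp_all

lemma R_feasible_nonneg:
  assumes "R_feasible v y" and "0 \<le> t"
  shows "0 \<le> y t $ 3"
  using R_feasibleD(6)[OF assms(1)] R_feasibleD(7)[OF assms(1), of t] assms(2) by (cases "t = 0") auto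

lemma R_feasible_continuous_on:
  assumes R: "R_feasible v y" and "0 \<le> a"
  shows "continuous_on {a..b} (\<lambda>t. y t $ 1)" "continuous_on {a..b} (\<lambda>t. y t $ 2)"
    "continuous_on {a..b} (\<lambda>t. y t $ 3)"
proof -
  have sub: "{a..b} \<subseteq> {0..}" using assms(2) by auto
  show "continuous_on {a..b} (\<lambda>t. y t $ 1)"
    by (rule ode_on_continuous_on[OF ode_on_subset[OF R_feasibleD(3)[OF R] sub]])
  show "continuous_on {a..b} (\<lambda>t. y t $ 2)"
    by (rule ode_on_continuous_on[OF ode_on_subset[OF R_feasibleD(2)[OF R] sub]])
  show "continuous_on {a..b} (\<lambda>t. y t $ 3)"
    by (rule ode_on_continuous_on[OF ode_on_subset[OF R_feasibleD(1)[OF R] sub]])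
qed

lemma R_cost_eq:
  assumes "R_feasible v y" and "((\<lambda>t. y t $ 3) has_integral I) {0<..}"
  shows "R_cost y = ennreal I"
  unfolding R_cost_def
  by (rule nn_integral_has_integral_lebesgue'[OF _ assms(2)]) (simp add: R_feasibleD(7)[OF assms(1)])

text \<open>Passage from the extended-valued cost to a real integral, which can be subtracted and
  averaged. Measurability comes from continuity on the open half-line.\<close>

lemma R_cost_finite:
  assumes R: "R_feasible v y" and fin: "R_cost y < top"
  shows "((\<lambda>t. y t $ 3) has_integral enn2real (R_cost y)) {0<..}"
proof -
  define f where "f t = indicator {0<..} t *\<^sub>R y t $ 3" for t
  have "f \<in> borel_measurable borel"
    unfolding f_def
    by (rule borel_measurable_continuous_on_indicator[OF _ ode_on_continuous_on_atLeast[OF R_feasibleD(1)[OF R]]]) simp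
  moreover have "0 \<le> f t" for t
    using R_feasibleD(7)[OF R] by (simp add: f_def indicator_def)
  moreover have "integral\<^sup>N lborel f = ennreal (enn2real (R_cost y))"
  proof -
    have "integral\<^sup>N lborel f = R_cost y"
      unfolding R_cost_def f_def by (rule nn_integral_cong) (simp add: indicator_def)
    then show ?thesis using fin by simp
  qed
  ultimately have "(f has_integral enn2real (R_cost y)) UNIV"
    by (intro nn_integral_has_integral) auto
  moreover have "f = (\<lambda>t. if t \<in> {0<..} then y t $ 3 else 0)"
    by (auto simp: f_def indicator_def fun_eq_iff)
  ultimately show ?thesis using has_integral_restrict_UNIV by metis
qed

lemma R_cost_bounds_integral:
  assumes R: "R_feasible v y" and J: "((\<lambda>t. y t $ 3) has_integral J) {0<..}"
  shows "integral {0..t} (\<lambda>t. y t $ 3) \<le> J"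
proof -
  have "(\<lambda>t. y t $ 3) integrable_on {0..t}"
    by (intro integrable_continuous_real R_feasible_continuous_on[OF R]) simp
  then have "(\<lambda>t. y t $ 3) integrable_on {0<..t}"
    by (rule integrable_spike_set) (auto intro: negligible_subset[OF negligible_sing[of 0]])
  then have "integral {0<..t} (\<lambda>t. y t $ 3) \<le> integral {0<..} (\<lambda>t. y t $ 3)"
    using J R_feasibleD(7)[OF R] by (intro integral_subset_le) auto
  moreover have "integral {0<..t} (\<lambda>t. y t $ 3) = integral {0..t} (\<lambda>t. y t $ 3)"
    by (rule integral_spike_set) (auto intro: negligible_subset[OF negligible_sing[of 0]])
  ultimately show ?thesis using integral_unique[OF J] by simp
qed

section \<open>Extremality of optimal controls off the state constraint\<close>

lemma R_optimal_le: "R_optimal v y \<Longrightarrow> R_feasible v' y' \<Longrightarrow> R_cost y \<le> R_cost y'"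
  unfolding R_optimal_def by blast

text \<open>The perturbation is subtracted so that a positive integral of \<open>H3\<close> lowers
  the cost. As \<open>H1\<close>, \<open>H2\<close>, \<open>H3\<close> vanish at both ends, nothing
  changes outside \<open>{a..b}\<close>. The control bound is asked only at positive times, as in
  (R).\<close>

lemma R_feasible_perturb:
  assumes R: "R_feasible v y" and ab: "0 \<le> a" "a \<le> b"
    and ode: "ode_on {a..b} H1 h" "ode_on {a..b} H2 H1" "ode_on {a..b} H3 H2"
    and zero: "H1 a = 0" "H2 a = 0" "H3 a = 0" "H1 b = 0" "H2 b = 0" "H3 b = 0"
    and v: "\<And>t. t \<in> {a..b} \<Longrightarrow> 0 < t \<Longrightarrow> \<bar>v t - e * h t\<bar> \<le> 1"
    and y: "\<And>t. t \<in> {a..b} \<Longrightarrow> e * H3 t \<le> y t $ 3"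
  defines "y' \<equiv> \<lambda>t. vector [y t $ 1 - e * H1 (max a (min b t)),
      y t $ 2 - e * H2 (max a (min b t)), y t $ 3 - e * H3 (max a (min b t))] :: real ^ 3"
  shows "R_feasible (\<lambda>t. v t - e * (if t \<in> {a..b} then h t else 0)) y'"
  unfolding R_feasible_def
proof (intro conjI ballI)
  have iv: "is_interval {0::real..}" by (rule is_interval_ci)
  show "ode_on {0..} (\<lambda>t. y' t $ 3) (\<lambda>t. y' t $ 2)"
    unfolding y'_def vector_3
    by (intro ode_on_diff ode_on_cmul R_feasibleD(1)[OF R] ode_on_clamp_chain[OF ode(3) ab(2) iv zero(2,5)])
  show "ode_on {0..} (\<lambda>t. y' t $ 2) (\<lambda>t. y' t $ 1)"
    unfolding y'_def vector_3
    by (intro ode_on_diff ode_on_cmul R_feasibleD(2)[OF R] ode_on_clamp_chain[OF ode(2) ab(2) iv zero(1,4)])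
  show "ode_on {0..} (\<lambda>t. y' t $ 1) (\<lambda>t. v t - e * (if t \<in> {a..b} then h t else 0))"
    unfolding y'_def vector_3
    by (intro ode_on_diff ode_on_cmul R_feasibleD(3)[OF R] ode_on_clamp[OF ode(1) ab(2)])
  have "max a (min b 0) = a" using ab by simp
  then show "y' 0 = vector [1, 0, 0]"
    unfolding y'_def using R_feasibleD(4-6)[OF R] zero by simp
  fix t :: real assume t: "t \<in> {0<..}"
  show "0 \<le> y' t $ 3"
  proof (cases "t \<in> {a..b}")
    case True
    then show ?thesis unfolding y'_def using y[OF True] by simp
  next
    case False
    then have "max a (min b t) = a \<or> max a (min b t) = b" using ab by auto
    then show ?thesis unfolding y'_def using zero R_feasibleD(7)[OF R, of t] t by auto
  qed
  show "\<bar>v t - e * (if t \<in> {a..b} then h t else 0)\<bar> \<le> 1"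
    using v[of t] R_feasibleD(8)[OF R, of t] t by simp
qed

text \<open>Where \<open>y3\<close> is bounded away from \<open>0\<close> and \<open>v\<close> from \<open>\<plusminus>1\<close>, a small perturbation violates no constraint
  and lowers the cost.\<close>
lemma R_optimal_saturated_compact:
  assumes opt: "R_optimal v y" and fin: "R_cost y < top" and ab: "0 \<le> a" "a \<le> b"
    and pos: "\<And>t. t \<in> {a..b} \<Longrightarrow> 0 < y t $ 3"
  shows "negligible {t \<in> {a..b}. \<bar>v t\<bar> < 1}"
proof -
  have R: "R_feasible v y" using opt by (simp add: R_optimal_def)
  \<comment> \<open>These sets exhaust \<open>\<bar>v t\<bar> < 1\<close>, and on each of them the
    control has the uniform slack \<open>1 / real (Suc n)\<close>.\<close>
  define E where "E n = {t \<in> {a..b}. \<bar>v t\<bar> \<le> 1 - 1 / real (Suc n)}" for n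
  have "negligible (E n)" for n
  proof (rule ccontr)
    assume nonnull: "\<not> negligible (E n)"
    have "v absolutely_integrable_on {a..b}" by (rule ode_onD(1)[OF R_feasibleD(3)[OF R]]) (use ab in auto)
    then have [measurable]: "v \<in> borel_measurable (lebesgue_on {a..b})"
      by (rule absolutely_integrable_imp_borel_measurable) simp
    have "{t \<in> space (lebesgue_on {a..b}). \<bar>v t\<bar> \<le> 1 - 1 / real (Suc n)} \<in> sets (lebesgue_on {a..b})"
      by measurable
    then have "E n \<in> sets lebesgue" by (simp add: E_def sets_restrict_space_iff)
    moreover have "E n \<subseteq> {a..b}" by (auto simp: E_def)
    ultimately obtain h B H1 H2 H3 H4 where
      hB: "\<And>t. \<bar>h t\<bar> \<le> B" and h0: "\<And>t. t \<notin> E n \<Longrightarrow> h t = 0" and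
      ode: "ode_on {a..b} H1 h" "ode_on {a..b} H2 H1" "ode_on {a..b} H3 H2" "ode_on {a..b} H4 H3" and
      zero: "H1 a = 0" "H2 a = 0" "H3 a = 0" "H4 a = 0" "H1 b = 0" "H2 b = 0" "H3 b = 0" and one: "H4 b = 1"
      using exists_moment_perturbation[OF _ _ nonnull ab(2)] by metis
    obtain C where C: "0 \<le> C" "\<And>t. t \<in> {a..b} \<Longrightarrow> \<bar>H3 t\<bar> \<le> C"
      using continuous_on_Icc_bounded[OF ode_on_continuous_on[OF ode(3)]] by metis
    obtain m where m: "m \<in> {a..b}" "\<And>t. t \<in> {a..b} \<Longrightarrow> y m $ 3 \<le> y t $ 3"
      using continuous_attains_inf[OF compact_Icc _ R_feasible_continuous_on(3)[OF R ab(1)], of b] ab by auto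
    have B: "0 \<le> B" using hB[of 0] by simp
    \<comment> \<open>The first entry keeps the change of control within the slack on
      \<open>E n\<close>, the second keeps the change of \<open>y3\<close> below its minimum on
      \<open>{a..b}\<close>; the added 1 avoids division by zero.\<close>
    define e where "e = min (1 / (real (Suc n) * (B + 1))) (y m $ 3 / (C + 1))"
    have e: "0 < e" using B C pos[OF m(1)] by (simp add: e_def)
    have eB: "e * B \<le> 1 / real (Suc n)"
    proof -
      have "e * B \<le> 1 / (real (Suc n) * (B + 1)) * (B + 1)"
        unfolding e_def using B pos[OF m(1)] C by (intro mult_mono) auto
      also have "\<dots> = 1 / real (Suc n)" using B by simp
      finally show ?thesis .
    qed
    have eC: "e * C \<le> y m $ 3"
    proof -
      have "e * C \<le> y m $ 3 / (C + 1) * (C + 1)"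
        unfolding e_def using B pos[OF m(1)] C by (intro mult_mono) auto
      also have "\<dots> = y m $ 3" using C by simp
      finally show ?thesis .
    qed
    let ?y = "\<lambda>t. vector [y t $ 1 - e * H1 (max a (min b t)),
      y t $ 2 - e * H2 (max a (min b t)), y t $ 3 - e * H3 (max a (min b t))] :: real ^ 3"
    have R': "R_feasible (\<lambda>t. v t - e * (if t \<in> {a..b} then h t else 0)) ?y"
    proof (rule R_feasible_perturb[OF R ab ode(1-3) zero(1-3,5-7)])
      fix t assume t: "t \<in> {a..b}"
      have "e * H3 t \<le> e * C" using C(2)[OF t] e by (intro mult_left_mono) auto
      then show "e * H3 t \<le> y t $ 3" using eC m(2)[OF t] by linarith
      assume "0 < t"
      show "\<bar>v t - e * h t\<bar> \<le> 1"
      proof (cases "t \<in> E n")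
        case True
        have "\<bar>e * h t\<bar> \<le> e * B" using hB[of t] e by (simp add: abs_mult)
        then show ?thesis using True eB unfolding E_def by auto
      next
        case False
        then show ?thesis using h0[OF False] R_feasibleD(8)[OF R \<open>0 < t\<close>] by simp
      qed
    qed
    define J where "J = enn2real (R_cost y)"
    have J: "((\<lambda>t. y t $ 3) has_integral J) {0<..}" unfolding J_def by (rule R_cost_finite[OF R fin])
    \<comment> \<open>The integral of \<open>H3\<close> is \<open>H4 b - H4 a = 1\<close>, so the
      cost drops by exactly \<open>e\<close>.\<close>
    have "((\<lambda>t. if t \<in> {a..b} then H3 t else 0) has_integral 1) UNIV"
      unfolding has_integral_restrict_UNIV using ode_onD(4)[OF ode(4), of a b] ab zero one by simp
    moreover have "(\<lambda>t. if t \<in> {a..b} then H3 t else 0) = (\<lambda>t. if t \<in> {0<..} then H3 (max a (min b t)) else 0)"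
    proof
      fix t
      consider "t < a" | "t \<in> {a..b}" | "b < t" by fastforce
      then show "(if t \<in> {a..b} then H3 t else 0) = (if t \<in> {0<..} then H3 (max a (min b t)) else 0)"
      proof cases
        case 2
        then show ?thesis using ab zero by (cases "t = 0") auto
      qed (use ab zero in auto)
    qed
    ultimately have "((\<lambda>t. H3 (max a (min b t))) has_integral 1) {0<..}"
      by (simp only: has_integral_restrict_UNIV)
    from has_integral_diff[OF J has_integral_mult_right[OF this, of e]]
    have J': "((\<lambda>t. ?y t $ 3) has_integral (J - e)) {0<..}" by simp
    \<comment> \<open>Needed because \<open>ennreal\<close> sends negative numbers to 0, which would
      hide the decrease.\<close>
    have "0 \<le> J - e" by (rule has_integral_nonneg[OF J' R_feasibleD(7)[OF R']]) simp
    moreover have "ennreal J \<le> ennreal (J - e)"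
      using R_optimal_le[OF opt R'] R_cost_eq[OF R J] R_cost_eq[OF R' J'] by simp
    ultimately show False using e by simp
  qed
  then have "negligible (\<Union>n. E n)" by (intro negligible_countable_Union) auto
  moreover have "{t \<in> {a..b}. \<bar>v t\<bar> < 1} \<subseteq> (\<Union>n. E n)"
  proof
    fix t assume t: "t \<in> {t \<in> {a..b}. \<bar>v t\<bar> < 1}"
    then obtain n where "inverse (real (Suc n)) < 1 - \<bar>v t\<bar>" using reals_Archimedean[of "1 - \<bar>v t\<bar>"] by auto
    then have "t \<in> E n" using t by (simp add: E_def inverse_eq_divide)
    then show "t \<in> (\<Union>n. E n)" by blast
  qed
  ultimately show ?thesis by (rule negligible_subset)
qed

text \<open>The open interval is exhausted by compact ones, since \<open>y3\<close> may tend to 0 at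
  its ends.\<close>

lemma R_optimal_saturated:
  assumes opt: "R_optimal v y" and fin: "R_cost y < top" and a: "0 \<le> a"
    and pos: "\<And>t. t \<in> {a<..<b} \<Longrightarrow> 0 < y t $ 3"
  shows "negligible {t \<in> {a<..<b}. \<bar>v t\<bar> < 1}"
proof -
  define I where "I n = {t \<in> {a + 1 / real (Suc n)..b - 1 / real (Suc n)}. \<bar>v t\<bar> < 1}" for n
  have "negligible (I n)" for n
  proof (cases "a + 1 / real (Suc n) \<le> b - 1 / real (Suc n)")
    case True
    have p: "0 < 1 / real (Suc n)" by simp
    show ?thesis
      unfolding I_def
    proof (rule R_optimal_saturated_compact[OF opt fin _ True])
      show "0 \<le> a + 1 / real (Suc n)" using a p by linarith
      fix t assume "t \<in> {a + 1 / real (Suc n)..b - 1 / real (Suc n)}"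
      then have "t \<in> {a<..<b}" using p unfolding atLeastAtMost_iff greaterThanLessThan_iff by linarith
      then show "0 < y t $ 3" by (rule pos)
    qed
  next
    case False
    then have "I n = {}" unfolding I_def by auto
    then show ?thesis by simp
  qed
  then have "negligible (\<Union>n. I n)" by (intro negligible_countable_Union) auto
  moreover have "{t \<in> {a<..<b}. \<bar>v t\<bar> < 1} \<subseteq> (\<Union>n. I n)"
  proof
    fix t assume t: "t \<in> {t \<in> {a<..<b}. \<bar>v t\<bar> < 1}"
    then obtain n where "inverse (real (Suc n)) < min (t - a) (b - t)"
      using reals_Archimedean[of "min (t - a) (b - t)"] by auto
    then have "t \<in> I n" using t by (simp add: I_def inverse_eq_divide)
    then show "t \<in> (\<Union>n. I n)" by blast
  qed
  ultimately show ?thesis by (rule negligible_subset)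
qed

section \<open>Stopping at the origin\<close>

lemma R_feasible_zero_after:
  assumes R: "R_feasible v y" and r: "0 \<le> r" and zero: "\<And>t. r \<le> t \<Longrightarrow> y t $ 3 = 0" and t: "r \<le> t"
  shows "y t = 0"
proof -
  have y2: "y s $ 2 = 0" if s: "r \<le> s" for s
  proof (rule ode_on_zero_imp_zero[of r "s + 1" "\<lambda>t. y t $ 3" "\<lambda>t. y t $ 2"])
    show "ode_on {r..s + 1} (\<lambda>t. y t $ 3) (\<lambda>t. y t $ 2)"
      by (rule ode_on_subset[OF R_feasibleD(1)[OF R]]) (use r in auto)
  qed (use s zero R_feasible_continuous_on[OF R r] in auto)
  have "y t $ 1 = 0"
  proof (rule ode_on_zero_imp_zero[of r "t + 1" "\<lambda>t. y t $ 2" "\<lambda>t. y t $ 1"])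
    show "ode_on {r..t + 1} (\<lambda>t. y t $ 2) (\<lambda>t. y t $ 1)"
      by (rule ode_on_subset[OF R_feasibleD(2)[OF R]]) (use r in auto)
  qed (use t y2 R_feasible_continuous_on[OF R r] in auto)
  then show ?thesis
    unfolding vec_eq_iff forall_3 using y2[OF t] zero[OF t] by simp
qed

lemma R_feasible_has_integral:
  assumes R: "R_feasible v y" and r: "0 \<le> r" and zero: "\<And>t. r \<le> t \<Longrightarrow> y t $ 3 = 0"
  shows "((\<lambda>t. y t $ 3) has_integral integral {0..r} (\<lambda>t. y t $ 3)) {0<..}"
proof -
  have "((\<lambda>t. y t $ 3) has_integral integral {0..r} (\<lambda>t. y t $ 3)) {0..r}"
    by (intro integrable_integral integrable_continuous_real R_feasible_continuous_on[OF R]) simp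
  then have "((\<lambda>t. if t \<in> {0..r} then y t $ 3 else 0) has_integral integral {0..r} (\<lambda>t. y t $ 3)) UNIV"
    by (simp only: has_integral_restrict_UNIV)
  moreover have "(\<lambda>t. if t \<in> {0..r} then y t $ 3 else 0) = (\<lambda>t. if t \<in> {0<..} then y t $ 3 else 0)"
  proof
    fix t
    show "(if t \<in> {0..r} then y t $ 3 else 0) = (if t \<in> {0<..} then y t $ 3 else 0)"
      using zero[of t] R_feasibleD(6)[OF R] by (cases "t = 0") auto
  qed
  ultimately show ?thesis by (simp only: has_integral_restrict_UNIV)
qed

text \<open>At the origin the control 0 keeps the state at rest. Used to stop an optimal trajectory
  of (R) and to extend a rescaled trajectory of (Q) to all times.\<close>

lemma R_feasible_truncate:
  assumes ode: "ode_on {0..r} y1 v" "ode_on {0..r} y2 y1" "ode_on {0..r} y3 y2"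
    and init: "y1 0 = 1" "y2 0 = 0" "y3 0 = 0" and r: "0 \<le> r"
    and final: "y1 r = 0" "y2 r = 0" "y3 r = 0"
    and nonneg: "\<And>t. t \<in> {0..r} \<Longrightarrow> 0 \<le> y3 t" and v: "\<And>t. t \<in> {0<..r} \<Longrightarrow> \<bar>v t\<bar> \<le> 1"
  shows "R_feasible (\<lambda>t. if t \<in> {0..r} then v t else 0)
    (\<lambda>t. vector [y1 (max 0 (min r t)), y2 (max 0 (min r t)), y3 (max 0 (min r t))])"
  unfolding R_feasible_def vector_3
proof (intro conjI ballI)
  have iv: "is_interval {0::real..}" by (rule is_interval_ci)
  show "ode_on {0..} (\<lambda>t. y3 (max 0 (min r t))) (\<lambda>t. y2 (max 0 (min r t)))"
    by (rule ode_on_clamp_chain[OF ode(3) r iv _ final(2)]) simp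
  show "ode_on {0..} (\<lambda>t. y2 (max 0 (min r t))) (\<lambda>t. y1 (max 0 (min r t)))"
    by (rule ode_on_clamp_chain[OF ode(2) r iv _ final(1)]) simp
  show "ode_on {0..} (\<lambda>t. y1 (max 0 (min r t))) (\<lambda>t. if t \<in> {0..r} then v t else 0)"
    by (rule ode_on_clamp[OF ode(1) r])
  show "(vector [y1 (max 0 (min r 0)), y2 (max 0 (min r 0)), y3 (max 0 (min r 0))] :: real ^ 3) = vector [1, 0, 0]"
    using r init by simp
  fix t :: real assume t: "t \<in> {0<..}"
  show "0 \<le> y3 (max 0 (min r t))" by (rule nonneg) (use r in auto)
  show "\<bar>if t \<in> {0..r} then v t else 0\<bar> \<le> 1" using v[of t] t by simp
qed

text \<open>The trajectory stopped at \<open>r\<close> is a competitor with the finite cost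
  accumulated up to \<open>r\<close>. Hence the cost after \<open>r\<close> is 0, and continuity
  with nonnegativity makes \<open>y3\<close> vanish there.\<close>

lemma R_optimal_zero_after:
  assumes opt: "R_optimal v y" and r: "0 < r" "y r = 0"
  shows "\<And>t. r \<le> t \<Longrightarrow> y t = 0" and "R_cost y = ennreal (integral {0..r} (\<lambda>t. y t $ 3))"
proof -
  have R: "R_feasible v y" using opt by (simp add: R_optimal_def)
  have r0: "0 \<le> r" using r by simp
  have yr: "y r $ 1 = 0" "y r $ 2 = 0" "y r $ 3 = 0" using r(2) by simp_all
  define I where "I s = integral {0..s} (\<lambda>t. y t $ 3)" for s
  let ?y = "\<lambda>t. vector [y (max 0 (min r t)) $ 1, y (max 0 (min r t)) $ 2, y (max 0 (min r t)) $ 3] :: real ^ 3"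
  have sub: "{0..r} \<subseteq> {0..}" by auto
  have R': "R_feasible (\<lambda>t. if t \<in> {0..r} then v t else 0) ?y"
    by (rule R_feasible_truncate[OF ode_on_subset[OF R_feasibleD(3)[OF R] sub]
          ode_on_subset[OF R_feasibleD(2)[OF R] sub] ode_on_subset[OF R_feasibleD(1)[OF R] sub]
          R_feasibleD(4-6)[OF R] r0 yr])
      (use R_feasible_nonneg[OF R] R_feasibleD(8)[OF R] in auto)
  have "integral {0..r} (\<lambda>t. ?y t $ 3) = I r"
    unfolding I_def by (rule integral_cong) simp
  then have cost': "R_cost ?y = ennreal (I r)"
    using R_cost_eq[OF R' R_feasible_has_integral[OF R' r0]] yr(3) r0 by simp
  have le: "R_cost y \<le> ennreal (I r)" using R_optimal_le[OF opt R'] cost' by simp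
  then have fin: "R_cost y < top" by (rule le_less_trans) simp
  define J where "J = enn2real (R_cost y)"
  have J: "((\<lambda>t. y t $ 3) has_integral J) {0<..}" unfolding J_def by (rule R_cost_finite[OF R fin])
  have I0: "0 \<le> I r"
    unfolding I_def
    by (intro Henstock_Kurzweil_Integration.integral_nonneg integrable_continuous_real
        R_feasible_continuous_on[OF R]) (use R_feasible_nonneg[OF R] in auto)
  have "ennreal J \<le> ennreal (I r)" using le fin unfolding J_def by simp
  then have JI: "J \<le> I r" using I0 by simp
  have y3: "y t $ 3 = 0" if t: "r \<le> t" for t
  proof (cases "r = t")
    case False
    have nn: "0 \<le> y s $ 3" if "s \<in> {r..t}" for s using R_feasible_nonneg[OF R] that r0 by auto
    have "I t \<le> J" unfolding I_def by (rule R_cost_bounds_integral[OF R J])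
    moreover have "I r + integral {r..t} (\<lambda>t. y t $ 3) = I t"
      unfolding I_def
      by (rule Henstock_Kurzweil_Integration.integral_combine[OF r0 t])
        (intro integrable_continuous_real R_feasible_continuous_on[OF R], simp)
    moreover have "0 \<le> integral {r..t} (\<lambda>t. y t $ 3)"
      by (intro Henstock_Kurzweil_Integration.integral_nonneg integrable_continuous_real
          R_feasible_continuous_on[OF R r0] nn)
    ultimately have "integral {r..t} (\<lambda>t. y t $ 3) = 0" using JI by linarith
    then show ?thesis
      using integral_eq_0_iff[OF R_feasible_continuous_on(3)[OF R r0] _ nn] False t by auto
  qed (use yr in simp)
  show "y t = 0" if "r \<le> t" for t
    by (rule R_feasible_zero_after[OF R r0 y3 that])
  show "R_cost y = ennreal (integral {0..r} (\<lambda>t. y t $ 3))"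
    by (rule R_cost_eq[OF R R_feasible_has_integral[OF R r0 y3]])
qed

section \<open>Contact with the state constraint and uniqueness\<close>

lemma R_feasible_touch:
  assumes R: "R_feasible v y" and t: "0 \<le> t" and zero: "y t $ 3 = 0"
  shows "y t $ 2 = 0"
proof (cases "t = 0")
  case False
  then have t0: "0 < t" using t by simp
  have "((\<lambda>t. y t $ 3) has_real_derivative y t $ 2) (at t within {0..t + 1})"
    by (rule ode_on_has_real_derivative[OF ode_on_subset[OF R_feasibleD(1)[OF R]] R_feasible_continuous_on(2)[OF R]])
      (use t0 in auto)
  then have "((\<lambda>t. y t $ 3) has_real_derivative y t $ 2) (at t)"
    using t0 by (simp add: at_within_Icc_at)
  then show ?thesis
    \<comment> \<open>At a positive contact time the nonnegative third component has an interior
      minimum.\<close>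
    by (rule DERIV_local_min[OF _ t0]) (use zero R_feasibleD(7)[OF R] in auto)
qed (use R_feasibleD(5)[OF R] in simp)

lemma R_optimal_midpoint:
  assumes y: "R_optimal v y" and w: "R_optimal u w" and fin: "R_cost y < top"
  defines "z \<equiv> \<lambda>t. vector [(y t $ 1 + w t $ 1) / 2, (y t $ 2 + w t $ 2) / 2, (y t $ 3 + w t $ 3) / 2] :: real ^ 3"
  shows "R_optimal (\<lambda>t. (v t + u t) / 2) z" and "R_cost z = R_cost y"
proof -
  have Ry: "R_feasible v y" and Rw: "R_feasible u w" using y w by (simp_all add: R_optimal_def)
  have eq: "R_cost w = R_cost y"
    using R_optimal_le[OF y Rw] R_optimal_le[OF w Ry] by simp
  have avg: "ode_on S (\<lambda>t. (F t + G t) / 2) (\<lambda>t. (f t + g t) / 2)"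
    if "ode_on S F f" "ode_on S G g" for S and F G f g :: "real \<Rightarrow> real"
    using ode_on_cmul[OF ode_on_add[OF that], of "1/2"] by simp
  have R: "R_feasible (\<lambda>t. (v t + u t) / 2) z"
    unfolding R_feasible_def z_def vector_3
  proof (intro conjI ballI avg)
    fix t :: real assume "t \<in> {0<..}"
    then have t: "0 < t" by simp
    show "0 \<le> (y t $ 3 + w t $ 3) / 2" using R_feasibleD(7)[OF Ry t] R_feasibleD(7)[OF Rw t] by simp
    show "\<bar>(v t + u t) / 2\<bar> \<le> 1" using R_feasibleD(8)[OF Ry t] R_feasibleD(8)[OF Rw t] by simp
  qed (use R_feasibleD[OF Ry] R_feasibleD[OF Rw] in simp_all)
  define J where "J = enn2real (R_cost y)"
  have "((\<lambda>t. y t $ 3) has_integral J) {0<..}" unfolding J_def by (rule R_cost_finite[OF Ry fin])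
  moreover have "((\<lambda>t. w t $ 3) has_integral J) {0<..}"
    using R_cost_finite[OF Rw] fin unfolding J_def eq by simp
  ultimately have "((\<lambda>t. (1/2) * (y t $ 3 + w t $ 3)) has_integral (1/2) * (J + J)) {0<..}"
    by (intro has_integral_mult_right has_integral_add)
  then have "((\<lambda>t. z t $ 3) has_integral J) {0<..}" by (simp add: z_def)
  then have "R_cost z = ennreal J" by (rule R_cost_eq[OF R])
  also have "\<dots> = R_cost y" unfolding J_def using fin by simp
  finally show eq': "R_cost z = R_cost y" .
  show "R_optimal (\<lambda>t. (v t + u t) / 2) z"
    unfolding R_optimal_def eq' using R y unfolding R_optimal_def by simp
qed

text \<open>The set of optimal controls is convex and its members are extremal off the zero set of
  their third component. Applied to the midpoint of two optimal solutions, this makes their controls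
  agree a.e. on each gap of the midpoint's zero set, so that the difference of the third components
  is there a quadratic polynomial with double zeros at both ends.\<close>
lemma R_optimal_unique:
  assumes y: "R_optimal v y" and w: "R_optimal u w" and fin: "R_cost y < top"
    and y0: "\<And>t. T \<le> t \<Longrightarrow> y t = 0" and w0: "\<And>t. T \<le> t \<Longrightarrow> w t = 0" and t: "0 \<le> t"
  shows "y t = w t"
proof -
  have Ry: "R_feasible v y" and Rw: "R_feasible u w" using y w by (simp_all add: R_optimal_def)
  define z where "z t = (vector [(y t $ 1 + w t $ 1) / 2, (y t $ 2 + w t $ 2) / 2, (y t $ 3 + w t $ 3) / 2] :: real ^ 3)" for t
  have oz: "R_optimal (\<lambda>t. (v t + u t) / 2) z" "R_cost z < top"
    unfolding z_def using R_optimal_midpoint[OF y w fin] fin by simp_all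
  have Rz: "R_feasible (\<lambda>t. (v t + u t) / 2) z" using oz by (simp add: R_optimal_def)
  have z3: "z t $ 3 = (y t $ 3 + w t $ 3) / 2" for t by (simp add: z_def)
  have zD: "y t $ 3 = 0" "w t $ 3 = 0" "y t $ 2 = 0" "w t $ 2 = 0" if "0 \<le> t" "z t $ 3 = 0" for t
  proof -
    show "y t $ 3 = 0" "w t $ 3 = 0"
      using R_feasible_nonneg[OF Ry that(1)] R_feasible_nonneg[OF Rw that(1)] that(2) unfolding z3 by simp_all
    then show "y t $ 2 = 0" "w t $ 2 = 0" using R_feasible_touch[OF Ry that(1)] R_feasible_touch[OF Rw that(1)] by simp_all
  qed
  have zT: "z t $ 3 = 0" if "T \<le> t" for t using y0[OF that] w0[OF that] by (simp add: z3)
  have main: "y t $ 3 - w t $ 3 = 0" if t: "0 \<le> t" for t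
  proof (cases "z t $ 3 = 0")
    case True
    then show ?thesis using zD[OF t] by simp
  next
    case False
    have tT: "t < T" using False zT[of t] by linarith
    define Z where "Z l r = {s \<in> {l..r}. z s $ 3 = 0}" for l r
    have comp: "compact (Z l r)" if "0 \<le> l" for l r
    proof -
      have "closed (Z l r)"
        unfolding Z_def
        by (rule continuous_closed_preimage_constant[OF R_feasible_continuous_on(3)[OF Rz that] closed_atLeastAtMost])
      then have "compact ({l..r} \<inter> Z l r)" by (intro compact_Int_closed) auto
      moreover have "{l..r} \<inter> Z l r = Z l r" by (auto simp: Z_def)
      ultimately show ?thesis by simp
    qed
    \<comment> \<open>The initial condition and the rest after \<open>T\<close> provide zeros on
      both sides of \<open>t\<close>, so \<open>t\<close> lies in a bounded gap
      \<open>{a<..<b}\<close>.\<close>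
    have "0 \<in> Z 0 t" using t R_feasibleD(6)[OF Rz] by (simp add: Z_def)
    then obtain a where a: "a \<in> Z 0 t" "\<And>s. s \<in> Z 0 t \<Longrightarrow> s \<le> a"
      using compact_attains_sup[OF comp[of 0 t]] by auto
    have "T \<in> Z t T" using tT zT by (simp add: Z_def)
    then obtain b where b: "b \<in> Z t T" "\<And>s. s \<in> Z t T \<Longrightarrow> b \<le> s"
      using compact_attains_inf[OF comp[OF t, of T]] by auto
    have ab: "0 \<le> a" "a < t" "t < b" "z a $ 3 = 0" "z b $ 3 = 0"
      using a(1) b(1) False unfolding Z_def by (force simp: less_le)+
    have pos: "0 < z s $ 3" if s: "s \<in> {a<..<b}" for s
    proof -
      have "z s $ 3 \<noteq> 0"
      proof
        assume "z s $ 3 = 0"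
        then have "s \<in> Z 0 t \<or> s \<in> Z t T" using s ab b(1) unfolding Z_def by auto
        then show False using a(2)[of s] b(2)[of s] s by auto
      qed
      then show ?thesis using R_feasible_nonneg[OF Rz, of s] s ab(1) by simp
    qed
    let ?d1 = "\<lambda>t. y t $ 1 - w t $ 1" and ?d2 = "\<lambda>t. y t $ 2 - w t $ 2" and ?d3 = "\<lambda>t. y t $ 3 - w t $ 3"
    have sub: "{a..b} \<subseteq> {0..}" using ab by auto
    have ode1: "ode_on {a..b} ?d1 (\<lambda>t. v t - u t)"
      by (intro ode_on_diff ode_on_subset[OF _ sub] R_feasibleD(3)[OF Ry] R_feasibleD(3)[OF Rw])
    have ode2: "ode_on {a..b} ?d2 ?d1"
      by (intro ode_on_diff ode_on_subset[OF _ sub] R_feasibleD(2)[OF Ry] R_feasibleD(2)[OF Rw])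
    have ode3: "ode_on {a..b} ?d3 ?d2"
      by (intro ode_on_diff ode_on_subset[OF _ sub] R_feasibleD(1)[OF Ry] R_feasibleD(1)[OF Rw])
    have neg: "negligible ({s \<in> {a<..<b}. \<bar>(v s + u s) / 2\<bar> < 1} \<union> {a, b})"
      using R_optimal_saturated[OF oz ab(1) pos] by simp
    \<comment> \<open>Different values in [-1, 1] have a mean of modulus less than 1, so the
      controls can differ only where the midpoint control is not extremal. The ends are set aside:
      \<open>a\<close> may be 0, where (R) does not bound the controls.\<close>
    have uv: "negligible {s \<in> {a..b}. v s - u s \<noteq> 0}"
    proof (rule negligible_subset[OF neg], rule subsetI)
      fix s assume s: "s \<in> {s \<in> {a..b}. v s - u s \<noteq> 0}"
      show "s \<in> {s \<in> {a<..<b}. \<bar>(v s + u s) / 2\<bar> < 1} \<union> {a, b}"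
      proof (cases "s = a \<or> s = b")
        case False
        then have s': "s \<in> {a<..<b}" using s by auto
        then have "\<bar>v s\<bar> \<le> 1" "\<bar>u s\<bar> \<le> 1" using R_feasibleD(8)[OF Ry, of s] R_feasibleD(8)[OF Rw, of s] ab by auto
        then have "\<bar>(v s + u s) / 2\<bar> < 1" using s by (auto simp: abs_if split: if_splits)
        then show ?thesis using s' by simp
      qed auto
    qed
    have "?d1 s = ?d1 a" if "s \<in> {a..b}" for s
      using ode_on_const[OF ode1 uv that] by simp
    then have "{s \<in> {a..b}. ?d1 s \<noteq> ?d1 a} = {}" by blast
    then have "negligible {s \<in> {a..b}. ?d1 s \<noteq> ?d1 a}" by (simp only: negligible_empty)
    note d2 = ode_on_const[OF ode2 this]
    \<comment> \<open>With \<open>?d1\<close> constant, \<open>?d2\<close> is affine; contact at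
      \<open>a\<close> and \<open>b\<close> makes it vanish at both ends, so its slope
      \<open>?d1 a\<close> is 0.\<close>
    have d2a: "?d2 a = 0" and d2b: "?d2 b = 0" and d3a: "?d3 a = 0" using zD[of a] zD[of b] ab by auto
    have "?d1 a * (b - a) = 0" using d2[of b] d2a d2b ab by simp
    then have "?d1 a = 0" using ab by simp
    then have "?d2 s = 0" if "s \<in> {a..b}" for s using d2[OF that] d2a by simp
    then have "{s \<in> {a..b}. ?d2 s \<noteq> 0} = {}" by blast
    then have "negligible {s \<in> {a..b}. ?d2 s \<noteq> 0}" by (simp only: negligible_empty)
    from ode_on_const[OF ode3 this, of t] show ?thesis using d3a ab by simp
  qed
  \<comment> \<open>Equality of the third components passes to the others by differentiation; the
    enlarged interval is nondegenerate even for \<open>t = 0\<close>.\<close>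
  have sub: "{0..t + 1} \<subseteq> {0..}" for t :: real by auto
  have d2: "y t $ 2 - w t $ 2 = 0" if "0 \<le> t" for t
    by (rule ode_on_zero_imp_zero[of 0 "t + 1" "\<lambda>t. y t $ 3 - w t $ 3" "\<lambda>t. y t $ 2 - w t $ 2"],
        intro ode_on_diff ode_on_subset[OF _ sub] R_feasibleD(1)[OF Ry] R_feasibleD(1)[OF Rw],
        intro continuous_on_diff R_feasible_continuous_on[OF Ry] R_feasible_continuous_on[OF Rw])
      (use that main in auto)
  have d1: "y t $ 1 - w t $ 1 = 0" if "0 \<le> t" for t
    by (rule ode_on_zero_imp_zero[of 0 "t + 1" "\<lambda>t. y t $ 2 - w t $ 2" "\<lambda>t. y t $ 1 - w t $ 1"],
        intro ode_on_diff ode_on_subset[OF _ sub] R_feasibleD(2)[OF Ry] R_feasibleD(2)[OF Rw],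
        intro continuous_on_diff R_feasible_continuous_on[OF Ry] R_feasible_continuous_on[OF Rw])
      (use that d2 in auto)
  show ?thesis
    unfolding vec_eq_iff forall_3 using main[OF t] d2[OF t] d1[OF t] by simp
qed

section \<open>Rescaling between (Q) and (R)\<close>

lemma Q_feasibleD:
  assumes "Q_feasible M0 M3 x01 x04 xf4 tf u x"
  shows "0 \<le> tf"
    "ode_on {0..tf} (\<lambda>t. x t $ 4) (\<lambda>t. x t $ 3)" "ode_on {0..tf} (\<lambda>t. x t $ 3) (\<lambda>t. x t $ 2)"
    "ode_on {0..tf} (\<lambda>t. x t $ 2) (\<lambda>t. x t $ 1)" "ode_on {0..tf} (\<lambda>t. x t $ 1) u"
    "x 0 $ 1 = x01" "x 0 $ 2 = 0" "x 0 $ 3 = M3" "x 0 $ 4 = x04"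
    "x tf $ 1 = 0" "x tf $ 2 = 0" "x tf $ 3 = M3" "x tf $ 4 = xf4"
    "\<And>t. t \<in> {0..tf} \<Longrightarrow> x t $ 3 \<le> M3" "\<And>t. t \<in> {0..tf} \<Longrightarrow> \<bar>u t\<bar> \<le> M0"
  using assms unfolding Q_feasible_def by simp_all

text \<open>Below, \<open>c\<close> stands for \<open>- x01 / M0\<close>, the unit of time. The value at \<open>0\<close> is reset because (R)
  leaves \<open>v 0\<close> unconstrained, whereas (Q) bounds \<open>u 0\<close>.\<close>
definition Q_control :: "real \<Rightarrow> real \<Rightarrow> (real \<Rightarrow> real) \<Rightarrow> real \<Rightarrow> real" where
  "Q_control M0 c v t = (if t = 0 then 0 else - M0 * v (t / c))"

text \<open>The powers of \<open>c\<close> count integrations: the control scales with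
  \<open>- M0\<close>, and each integration in time stretched by \<open>c\<close> contributes one
  more factor \<open>c\<close>.\<close>

definition Q_state :: "real \<Rightarrow> real \<Rightarrow> real \<Rightarrow> real \<Rightarrow> (real \<Rightarrow> real ^ 3) \<Rightarrow> real \<Rightarrow> real ^ 4" where
  "Q_state M0 M3 x04 c y t = vector [- (c * M0) * y (t / c) $ 1, - (c ^ 2 * M0) * y (t / c) $ 2,
     M3 - c ^ 3 * M0 * y (t / c) $ 3, x04 + M3 * t - c ^ 4 * M0 * integral {0..t / c} (\<lambda>s. y s $ 3)]"

text \<open>Any zero \<open>r\<close> of \<open>y\<close> is allowed, not only the first: after
  reaching the target the optimal trajectory keeps \<open>x3\<close> at \<open>M3\<close> while
  \<open>x4\<close> travels to its final value.\<close>

lemma Q_feasible_of_R_feasible: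
  assumes R: "R_feasible v y" and M0: "0 < M0" and c: "0 < c" and r: "0 \<le> r" "y r = 0"
  shows "Q_feasible M0 M3 (- (c * M0)) x04 (x04 + M3 * (c * r) - c ^ 4 * M0 * integral {0..r} (\<lambda>s. y s $ 3))
    (c * r) (Q_control M0 c v) (Q_state M0 M3 x04 c y)"
  unfolding Q_feasible_def
proof (intro conjI ballI)
  let ?x = "Q_state M0 M3 x04 c y"
  have iv: "is_interval {0..c * r}" by (rule is_interval_cc)
  have stretch: "ode_on {0..c * r} (\<lambda>t. F (t / c)) (\<lambda>t. f (t / c) / c)" if "ode_on {0..} F f" for F f
    using ode_on_stretch[OF that, of "1 / c" "{0..c * r}"] c by simp
  have y3: "(\<lambda>t. y t $ 3) absolutely_integrable_on {0..r}" for r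
    by (rule absolutely_integrable_continuous_real[OF R_feasible_continuous_on(3)[OF R order_refl]])
  have int: "ode_on {0..} (\<lambda>t. integral {0..t} (\<lambda>s. y s $ 3)) (\<lambda>t. y t $ 3)"
    unfolding ode_on_def
  proof (intro ballI impI)
    fix a b :: real assume "a \<in> {0..}" "b \<in> {0..}" "a \<le> b"
    then show "(\<lambda>t. y t $ 3) absolutely_integrable_on {a..b} \<and>
        integral {0..b} (\<lambda>s. y s $ 3) - integral {0..a} (\<lambda>s. y s $ 3) = integral {a..b} (\<lambda>t. y t $ 3)"
      using ode_on_indefinite[OF y3[of b]] unfolding ode_on_def by simp
  qed
  have const: "ode_on {0..c * r} (\<lambda>t. M3 * t) (\<lambda>t. M3)"
  proof (rule ode_onI)
    fix a b :: real assume "a \<in> {0..c * r}" "b \<in> {0..c * r}" "a \<le> b"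
    then show "((\<lambda>t. M3) has_integral (M3 * b - M3 * a)) {a..b}"
      using has_integral_const_real[of M3 a b] by (simp add: algebra_simps)
  qed (intro absolutely_integrable_continuous_real continuous_intros)
  show "ode_on {0..c * r} (\<lambda>t. ?x t $ 4) (\<lambda>t. ?x t $ 3)"
    by (rule ode_on_cong[OF ode_on_add_const[OF ode_on_diff[OF const ode_on_cmul[OF stretch[OF int], of "c ^ 4 * M0"]], of x04] iv])
      (use c in \<open>simp_all add: Q_state_def power4_eq_xxxx power3_eq_cube\<close>)
  show "ode_on {0..c * r} (\<lambda>t. ?x t $ 3) (\<lambda>t. ?x t $ 2)"
    by (rule ode_on_cong[OF ode_on_add_const[OF ode_on_cmul[OF stretch[OF R_feasibleD(1)[OF R]], of "- (c ^ 3 * M0)"], of M3] iv])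
      (use c in \<open>simp_all add: Q_state_def power2_eq_square power3_eq_cube\<close>)
  show "ode_on {0..c * r} (\<lambda>t. ?x t $ 2) (\<lambda>t. ?x t $ 1)"
    by (rule ode_on_cong[OF ode_on_cmul[OF stretch[OF R_feasibleD(2)[OF R]], of "- (c ^ 2 * M0)"] iv])
      (use c in \<open>simp_all add: Q_state_def power2_eq_square\<close>)
  show "ode_on {0..c * r} (\<lambda>t. ?x t $ 1) (Q_control M0 c v)"
    by (rule ode_on_spike[OF ode_on_cmul[OF stretch[OF R_feasibleD(3)[OF R]], of "- (c * M0)"] iv negligible_sing[of 0]])
      (use c in \<open>simp_all add: Q_state_def Q_control_def\<close>)
  show "?x 0 = vector [- (c * M0), 0, M3, x04]"
    using R_feasibleD(4-6)[OF R] by (simp add: Q_state_def)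
  show "?x (c * r) = vector [0, 0, M3, x04 + M3 * (c * r) - c ^ 4 * M0 * integral {0..r} (\<lambda>s. y s $ 3)]"
    using c r(2) by (simp add: Q_state_def)
  show "0 \<le> c * r" using c r by simp
  fix t assume t: "t \<in> {0..c * r}"
  have "0 \<le> t / c" using t c by simp
  then show "?x t $ 3 \<le> M3"
    using R_feasible_nonneg[OF R] c M0 by (simp add: Q_state_def)
  show "\<bar>Q_control M0 c v t\<bar> \<le> M0"
  proof (cases "t = 0")
    case False
    then have "\<bar>v (t / c)\<bar> \<le> 1" using R_feasibleD(8)[OF R, of "t / c"] t c by simp
    then have "M0 * \<bar>v (t / c)\<bar> \<le> M0" using M0 by simp
    then show ?thesis using M0 False by (simp add: Q_control_def abs_mult)
  qed (use M0 in \<open>simp add: Q_control_def\<close>)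
qed

text \<open>The time identity is the integral of \<open>x3 = M3 - c ^ 3 * M0 * w3\<close> over
  \<open>{0..tf}\<close>, the change of time giving the fourth factor \<open>c\<close>. The fourth
  component imposes nothing further.\<close>

lemma R_feasible_of_Q_feasible:
  assumes Q: "Q_feasible M0 M3 (- (c * M0)) x04 xf4 tf u x" and M0: "0 < M0" and c: "0 < c"
  obtains v w I where "R_feasible v w" "\<And>t. tf / c \<le> t \<Longrightarrow> w t = 0" "R_cost w = ennreal I" "0 \<le> I"
    "M3 * tf = xf4 - x04 + c ^ 4 * M0 * I"
    "\<And>t. t \<in> {0..tf} \<Longrightarrow> x t $ 1 = - (c * M0) * w (t / c) $ 1"
    "\<And>t. t \<in> {0..tf} \<Longrightarrow> x t $ 2 = - (c ^ 2 * M0) * w (t / c) $ 2"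
    "\<And>t. t \<in> {0..tf} \<Longrightarrow> x t $ 3 = M3 - c ^ 3 * M0 * w (t / c) $ 3"
proof -
  define r where "r = tf / c"
  have tf: "tf = c * r" using c by (simp add: r_def)
  have r: "0 \<le> r" using Q_feasibleD(1)[OF Q] c by (simp add: r_def)
  have iv: "is_interval {0..r}" by (rule is_interval_cc)
  define y1 where "y1 t = - (1 / (c * M0)) * x (c * t) $ 1" for t
  define y2 where "y2 t = - (1 / (c ^ 2 * M0)) * x (c * t) $ 2" for t
  define y3 where "y3 t = - (1 / (c ^ 3 * M0)) * x (c * t) $ 3 + M3 / (c ^ 3 * M0)" for t
  define v where "v t = - (1 / M0) * u (c * t)" for t
  have ct: "c * t \<in> {0..tf}" if "t \<in> {0..r}" for t
    using that c unfolding tf by simp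
  have stretch: "ode_on {0..r} (\<lambda>t. F (c * t)) (\<lambda>t. c * f (c * t))" if "ode_on {0..tf} F f" for F f
    by (rule ode_on_stretch[OF that c ct])
  have ode: "ode_on {0..r} y1 v" "ode_on {0..r} y2 y1" "ode_on {0..r} y3 y2"
  proof -
    show "ode_on {0..r} y1 v"
      by (rule ode_on_cong[OF ode_on_cmul[OF stretch[OF Q_feasibleD(5)[OF Q]], of "- (1 / (c * M0))"] iv])
        (use c M0 in \<open>simp_all add: y1_def v_def\<close>)
    show "ode_on {0..r} y2 y1"
      by (rule ode_on_cong[OF ode_on_cmul[OF stretch[OF Q_feasibleD(4)[OF Q]], of "- (1 / (c ^ 2 * M0))"] iv])
        (use c M0 in \<open>simp_all add: y1_def y2_def power2_eq_square\<close>)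
    show "ode_on {0..r} y3 y2"
      by (rule ode_on_cong[OF ode_on_add_const[OF ode_on_cmul[OF stretch[OF Q_feasibleD(3)[OF Q]],
              of "- (1 / (c ^ 3 * M0))"], of "M3 / (c ^ 3 * M0)"] iv])
        (use c M0 in \<open>simp_all add: y2_def y3_def power2_eq_square power3_eq_cube\<close>)
  qed
  have init: "y1 0 = 1" "y2 0 = 0" "y3 0 = 0"
    using Q_feasibleD(6-8)[OF Q] c M0 by (simp_all add: y1_def y2_def y3_def)
  have final: "y1 r = 0" "y2 r = 0" "y3 r = 0"
    using Q_feasibleD(10-12)[OF Q] by (simp_all add: y1_def y2_def y3_def tf)
  have nonneg: "0 \<le> y3 t" if "t \<in> {0..r}" for t
    using Q_feasibleD(14)[OF Q ct[OF that]] c M0 by (simp add: y3_def divide_right_mono)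
  have v: "\<bar>v t\<bar> \<le> 1" if "t \<in> {0<..r}" for t
  proof -
    have "\<bar>u (c * t)\<bar> \<le> M0" by (rule Q_feasibleD(15)[OF Q ct]) (use that in auto)
    then show ?thesis using M0 by (simp add: v_def abs_mult)
  qed
  let ?v = "\<lambda>t. if t \<in> {0..r} then v t else 0"
  define w where "w t = (vector [y1 (max 0 (min r t)), y2 (max 0 (min r t)), y3 (max 0 (min r t))] :: real ^ 3)" for t
  have R: "R_feasible ?v w"
    unfolding w_def by (rule R_feasible_truncate[OF ode init r final nonneg v])
  have w0: "w t = 0" if "r \<le> t" for t
    unfolding w_def vec_eq_iff forall_3 using that r final by simp
  define I where "I = integral {0..r} (\<lambda>t. w t $ 3)"
  have cost: "R_cost w = ennreal I"
    unfolding I_def by (rule R_cost_eq[OF R R_feasible_has_integral[OF R r]]) (use w0 in simp)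
  have int: "(\<lambda>t. w t $ 3) integrable_on {0..r}"
    by (intro integrable_continuous_real R_feasible_continuous_on[OF R]) simp
  have I0: "0 \<le> I"
    unfolding I_def using R_feasible_nonneg[OF R] by (intro Henstock_Kurzweil_Integration.integral_nonneg int) simp
  have w3: "w t $ 3 = (M3 - x (c * t) $ 3) / (c ^ 3 * M0)" if "t \<in> {0..r}" for t
    using that by (simp add: w_def y3_def diff_divide_distrib)
  have "((\<lambda>t. c * M3 - c ^ 4 * M0 * w t $ 3) has_integral (c * M3 * r - c ^ 4 * M0 * I)) {0..r}"
    unfolding I_def
    using has_integral_const_real[of "c * M3" 0 r] r
    by (intro has_integral_diff has_integral_mult_right integrable_integral int) (simp add: mult.commute)
  then have "((\<lambda>t. c * x (c * t) $ 3) has_integral (c * M3 * r - c ^ 4 * M0 * I)) {0..r}"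
  proof (rule has_integral_eq[rotated])
    fix t assume "t \<in> {0..r}"
    from w3[OF this] have x: "x (c * t) $ 3 = M3 - c ^ 3 * M0 * w t $ 3" using c M0 by simp
    show "c * M3 - c ^ 4 * M0 * w t $ 3 = c * x (c * t) $ 3"
      unfolding x by (simp add: algebra_simps eval_nat_numeral)
  qed
  moreover have "((\<lambda>t. c * x (c * t) $ 3) has_integral (xf4 - x04)) {0..r}"
    using ode_onD(4)[OF stretch[OF Q_feasibleD(2)[OF Q]], of 0 r] r Q_feasibleD(9,13)[OF Q]
    by (simp add: tf)
  ultimately have "c * M3 * r - c ^ 4 * M0 * I = xf4 - x04" by (rule has_integral_unique)
  then have M3tf: "M3 * tf = xf4 - x04 + c ^ 4 * M0 * I" by (simp add: tf algebra_simps)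
  have tc: "max 0 (min r (t / c)) = t / c" if "t \<in> {0..tf}" for t
    using that c by (simp add: tf field_simps)
  show thesis
  proof (rule that[of ?v w I])
    fix t assume t: "t \<in> {0..tf}"
    show "x t $ 1 = - (c * M0) * w (t / c) $ 1"
      unfolding w_def tc[OF t] using c M0 by (simp add: y1_def)
    show "x t $ 2 = - (c ^ 2 * M0) * w (t / c) $ 2"
      unfolding w_def tc[OF t] using c M0 by (simp add: y2_def)
    show "x t $ 3 = M3 - c ^ 3 * M0 * w (t / c) $ 3"
      unfolding w_def tc[OF t] using c M0 by (simp add: y3_def field_simps)
  qed (use R w0 cost I0 M3tf in \<open>simp_all add: r_def\<close>)
qed

theorem theorem3:
  fixes M0 M3 x01 x04 xf4 J \<tau>_inf :: real
    and v :: "real \<Rightarrow> real" and y :: "real \<Rightarrow> real ^ 3"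
  assumes "0 < M0" and "0 < M3" and "x01 < 0"
    and "R_optimal v y"
    and "J = enn2real (R_cost y)"
    and "leastP (\<lambda>\<tau>. \<tau> \<in> {0<..} \<and> y \<tau> = 0) \<tau>_inf"
    and "xf4 - x04 \<ge> - (x01 / M0) * (x01 ^ 3 / M0 ^ 2 * J + M3 * \<tau>_inf)"
  shows "(\<exists>tf u x. Q_optimal M0 M3 x01 x04 xf4 tf u x) \<and>
    (\<forall>tf u x. Q_optimal M0 M3 x01 x04 xf4 tf u x \<longrightarrow>
      (\<exists>t_inf. leastP (Q_at_target M3 tf x) t_inf \<and>
         t_inf = - (x01 / M0) * \<tau>_inf \<and> 0 < t_inf \<and>
         tf = (xf4 - x04) / M3 + x01 ^ 4 * J / (M0 ^ 3 * M3) \<and> t_inf \<le> tf) \<and>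
      (AE t\<in>{0<..<tf} in lebesgue.
         u t = - M0 * v (- (M0 / x01) * t) \<and>
         x t $ 1 = x01 * y (- (M0 / x01) * t) $ 1 \<and>
         x t $ 2 = - (x01 ^ 2 / M0) * y (- (M0 / x01) * t) $ 2 \<and>
         x t $ 3 = x01 ^ 3 / M0 ^ 2 * y (- (M0 / x01) * t) $ 3 + M3 \<and>
         x t $ 4 = - (x01 ^ 4 / M0 ^ 3) * integral {0..- (M0 / x01) * t} (\<lambda>\<tau>. y \<tau> $ 3)
                   + M3 * t + x04))"
proof -
  note M0 = assms(1) and M3 = assms(2) and x01_neg = assms(3) and opt = assms(4)
  define c where "c = - x01 / M0"
  have c: "0 < c" using divide_neg_pos[OF x01_neg M0] by (simp add: c_def)
  have x01: "x01 = - (c * M0)" using M0 by (simp add: c_def)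
  have coeffs: "- (x01 / M0) = c" "- (M0 / x01) = 1 / c" "x01 ^ 2 / M0 = c ^ 2 * M0"
    "x01 ^ 3 / M0 ^ 2 = - (c ^ 3 * M0)" "x01 ^ 4 / M0 ^ 3 = c ^ 4 * M0"
    "x01 ^ 4 * J / (M0 ^ 3 * M3) = c ^ 4 * M0 * J / M3"
    unfolding x01 using M0 c by (simp_all add: power_mult_distrib eval_nat_numeral)
  have R: "R_feasible v y" using opt by (simp add: R_optimal_def)
  have \<tau>: "0 < \<tau>_inf" "y \<tau>_inf = 0" using leastPD1[OF assms(6)] by simp_all
  have least: "\<tau>_inf \<le> t" if "0 < t" "y t = 0" for t
    using leastPD3[OF assms(6), of t] that by simp
  note zero = R_optimal_zero_after(1)[OF opt \<tau>]
  have J0: "0 \<le> J" using assms(5) by simp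
  have cost: "R_cost y = ennreal J"
    using R_optimal_zero_after(2)[OF opt \<tau>] assms(5) by simp
  \<comment> \<open>Nothing accumulates after \<open>\<tau>_inf\<close>, so the full cost is
    attained on every longer interval, in particular at the rescaled terminal time.\<close>
  have J: "integral {0..r} (\<lambda>s. y s $ 3) = J" if "\<tau>_inf \<le> r" for r
  proof -
    have "0 < r" "y r = 0" using that \<tau>(1) zero[OF that] by simp_all
    from R_optimal_zero_after(2)[OF opt this]
    have "J = enn2real (ennreal (integral {0..r} (\<lambda>s. y s $ 3)))" using assms(5) by simp
    moreover have "0 \<le> integral {0..r} (\<lambda>s. y s $ 3)"
      by (intro Henstock_Kurzweil_Integration.integral_nonneg integrable_continuous_real
          R_feasible_continuous_on[OF R]) (use R_feasible_nonneg[OF R] in auto)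
    ultimately show ?thesis by simp
  qed
  \<comment> \<open>Solves the time identity for cost \<open>J\<close>.\<close>
  define tf where "tf = (xf4 - x04) / M3 + c ^ 4 * M0 * J / M3"
  define r where "r = tf / c"
  have tf: "tf = c * r" using c by (simp add: r_def)
  have M3tf: "M3 * tf = xf4 - x04 + c ^ 4 * M0 * J" using M3 by (simp add: tf_def field_simps)
  \<comment> \<open>After inserting \<open>x01 = - (c * M0)\<close>, this is the assumed lower bound
    on \<open>xf4 - x04\<close> with \<open>c ^ 4 * M0 * J\<close> added to both sides.\<close>
  have "c * \<tau>_inf * M3 \<le> tf * M3"
    using assms(7) M3tf unfolding coeffs by (simp add: algebra_simps eval_nat_numeral)
  then have \<tau>_tf: "c * \<tau>_inf \<le> tf" using M3 by simp
  then have \<tau>_r: "\<tau>_inf \<le> r" using c by (simp add: tf)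
  have r: "0 \<le> r" "y r = 0" using \<tau>_r \<tau>(1) zero by auto
  let ?u = "Q_control M0 c v" and ?x = "Q_state M0 M3 x04 c y"
  have feas: "Q_feasible M0 M3 x01 x04 xf4 tf ?u ?x"
    using Q_feasible_of_R_feasible[OF R M0 c r, of M3 x04] M3tf
    unfolding x01 J[OF \<tau>_r] tf[symmetric] by (simp add: algebra_simps)
  have lower: "tf \<le> tf'" if Q': "Q_feasible M0 M3 x01 x04 xf4 tf' u' x'" for tf' u' x'
  proof -
    obtain v' w I where w: "R_feasible v' w" "R_cost w = ennreal I" "0 \<le> I"
      "M3 * tf' = xf4 - x04 + c ^ 4 * M0 * I"
      using R_feasible_of_Q_feasible[OF Q'[unfolded x01] M0 c] by metis
    have "ennreal J \<le> ennreal I" using R_optimal_le[OF opt w(1)] cost w(2) by simp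
    then have "c ^ 4 * M0 * J \<le> c ^ 4 * M0 * I" using w(3) c M0 by (intro mult_left_mono) simp_all
    then have "M3 * tf \<le> M3 * tf'" unfolding M3tf w(4) by simp
    then show ?thesis using M3 by simp
  qed
  have ex: "Q_optimal M0 M3 x01 x04 xf4 tf ?u ?x"
    using feas lower unfolding Q_optimal_def by blast
  have uniq: "(\<exists>t_inf. leastP (Q_at_target M3 tf' x) t_inf \<and>
         t_inf = - (x01 / M0) * \<tau>_inf \<and> 0 < t_inf \<and>
         tf' = (xf4 - x04) / M3 + x01 ^ 4 * J / (M0 ^ 3 * M3) \<and> t_inf \<le> tf') \<and>
      (AE t\<in>{0<..<tf'} in lebesgue.
         u t = - M0 * v (- (M0 / x01) * t) \<and>
         x t $ 1 = x01 * y (- (M0 / x01) * t) $ 1 \<and>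
         x t $ 2 = - (x01 ^ 2 / M0) * y (- (M0 / x01) * t) $ 2 \<and>
         x t $ 3 = x01 ^ 3 / M0 ^ 2 * y (- (M0 / x01) * t) $ 3 + M3 \<and>
         x t $ 4 = - (x01 ^ 4 / M0 ^ 3) * integral {0..- (M0 / x01) * t} (\<lambda>\<tau>. y \<tau> $ 3)
                   + M3 * t + x04)"
    if "Q_optimal M0 M3 x01 x04 xf4 tf' u x" for tf' u x
  proof -
    have Q': "Q_feasible M0 M3 x01 x04 xf4 tf' u x" using that by (simp add: Q_optimal_def)
    have "tf' \<le> tf" using that feas unfolding Q_optimal_def by blast
    with lower[OF Q'] have tf': "tf' = tf" by simp
    note Q = Q'[unfolded tf']
    obtain v' w I where w: "R_feasible v' w" "\<And>t. tf / c \<le> t \<Longrightarrow> w t = 0" "R_cost w = ennreal I"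
      "M3 * tf = xf4 - x04 + c ^ 4 * M0 * I"
      and xw: "\<And>t. t \<in> {0..tf} \<Longrightarrow> x t $ 1 = - (c * M0) * w (t / c) $ 1"
        "\<And>t. t \<in> {0..tf} \<Longrightarrow> x t $ 2 = - (c ^ 2 * M0) * w (t / c) $ 2"
        "\<And>t. t \<in> {0..tf} \<Longrightarrow> x t $ 3 = M3 - c ^ 3 * M0 * w (t / c) $ 3"
      using R_feasible_of_Q_feasible[OF Q[unfolded x01] M0 c] by metis
    \<comment> \<open>Equal terminal times force equal costs, so the trajectory of (R) obtained from
      \<open>x\<close> is itself optimal and uniqueness applies to it.\<close>
    have "I = J" using M3tf w(4) c M0 by simp
    then have "R_cost w = R_cost y" using w(3) cost by simp
    then have optw: "R_optimal v' w"
      unfolding R_optimal_def using w(1) R_optimal_le[OF opt] by simp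
    have yw: "y t = w t" if "0 \<le> t" for t
    proof (rule R_optimal_unique[OF opt optw _ _ _ that])
      show "R_cost y < top" using cost by simp
      show "y t = 0" if "r \<le> t" for t by (rule zero) (use that \<tau>_r in simp)
      show "w t = 0" if "r \<le> t" for t by (rule w(2)) (use that in \<open>simp add: r_def\<close>)
    qed
    have x123: "x t $ 1 = ?x t $ 1" "x t $ 2 = ?x t $ 2" "x t $ 3 = ?x t $ 3" if "t \<in> {0..tf}" for t
    proof -
      have "0 \<le> t / c" using that c by simp
      from yw[OF this] show "x t $ 1 = ?x t $ 1" "x t $ 2 = ?x t $ 2" "x t $ 3 = ?x t $ 3"
        using xw[OF that] by (simp_all add: Q_state_def)
    qed
    have x4: "x t $ 4 = ?x t $ 4" if t: "t \<in> {0..tf}" for t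
    proof -
      have st: "0 \<in> {0..tf}" "0 \<le> t" using t by auto
      have "((\<lambda>t. ?x t $ 3) has_integral (x t $ 4 - x 0 $ 4)) {0..t}"
        by (rule has_integral_eq[rotated, OF ode_onD(4)[OF Q_feasibleD(2)[OF Q] st(1) t st(2)]])
          (use x123(3) t in auto)
      from has_integral_unique[OF this ode_onD(4)[OF Q_feasibleD(2)[OF feas] st(1) t st(2)]]
      show ?thesis using Q_feasibleD(9)[OF Q] Q_feasibleD(9)[OF feas] by simp
    qed
    \<comment> \<open>Both controls have the primitive \<open>x1\<close>, hence agree a.e.; this is
      why the control formula holds only almost everywhere.\<close>
    have "ode_on {0..tf} (\<lambda>t. x t $ 1) ?u"
      by (rule ode_on_cong[OF Q_feasibleD(5)[OF feas] is_interval_cc]) (simp_all add: x123)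
    from ode_on_unique_negligible[OF Q_feasibleD(5)[OF Q] this]
    have neg: "negligible {t \<in> {0..tf}. u t \<noteq> ?u t}" .
    have target: "Q_at_target M3 tf x t \<longleftrightarrow> t \<in> {0..tf} \<and> y (t / c) = 0" for t
      unfolding Q_at_target_def vec_eq_iff forall_3 using x123[of t] c M0 by (auto simp: Q_state_def)
    have "leastP (Q_at_target M3 tf x) (c * \<tau>_inf)"
      unfolding leastP_def setge_def
    proof (intro conjI ballI)
      show "Q_at_target M3 tf x (c * \<tau>_inf)" unfolding target using \<tau>_tf \<tau> c by simp
      fix t assume "t \<in> Collect (Q_at_target M3 tf x)"
      then have t: "t \<in> {0..tf}" "y (t / c) = 0" using target by auto
      \<comment> \<open>Minimality of \<open>\<tau>_inf\<close> concerns positive times only; time 0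
        is excluded by \<open>y1 = 1\<close> there.\<close>
      have "t \<noteq> 0" using t(2) R_feasibleD(4)[OF R] by auto
      then have "\<tau>_inf \<le> t / c" using t c by (intro least) auto
      then show "c * \<tau>_inf \<le> t" using c by (simp add: field_simps)
    qed
    moreover have "AE t\<in>{0<..<tf} in lebesgue.
         u t = - M0 * v (1 / c * t) \<and>
         x t $ 1 = x01 * y (1 / c * t) $ 1 \<and>
         x t $ 2 = - (c ^ 2 * M0) * y (1 / c * t) $ 2 \<and>
         x t $ 3 = - (c ^ 3 * M0) * y (1 / c * t) $ 3 + M3 \<and>
         x t $ 4 = - (c ^ 4 * M0) * integral {0..1 / c * t} (\<lambda>\<tau>. y \<tau> $ 3) + M3 * t + x04"
      unfolding eventually_ae_filter_negligible
    proof (intro exI[of _ "{t \<in> {0..tf}. u t \<noteq> ?u t}"] conjI neg)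
      have "u t = - M0 * v (1 / c * t) \<and>
         x t $ 1 = x01 * y (1 / c * t) $ 1 \<and>
         x t $ 2 = - (c ^ 2 * M0) * y (1 / c * t) $ 2 \<and>
         x t $ 3 = - (c ^ 3 * M0) * y (1 / c * t) $ 3 + M3 \<and>
         x t $ 4 = - (c ^ 4 * M0) * integral {0..1 / c * t} (\<lambda>\<tau>. y \<tau> $ 3) + M3 * t + x04"
        if t: "t \<in> {0<..<tf}" and u: "u t = ?u t" for t
      proof -
        have t': "t \<in> {0..tf}" using t by simp
        show ?thesis
          using t u x123[OF t'] x4[OF t'] by (simp add: Q_state_def Q_control_def x01)
      qed
      then show "{t. \<not> (t \<in> {0<..<tf} \<longrightarrow> u t = - M0 * v (1 / c * t) \<and>
         x t $ 1 = x01 * y (1 / c * t) $ 1 \<and>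
         x t $ 2 = - (c ^ 2 * M0) * y (1 / c * t) $ 2 \<and>
         x t $ 3 = - (c ^ 3 * M0) * y (1 / c * t) $ 3 + M3 \<and>
         x t $ 4 = - (c ^ 4 * M0) * integral {0..1 / c * t} (\<lambda>\<tau>. y \<tau> $ 3) + M3 * t + x04)}
        \<subseteq> {t \<in> {0..tf}. u t \<noteq> ?u t}"
        by force
    qed
    ultimately show ?thesis
      using \<tau>(1) c \<tau>_tf unfolding tf' coeffs tf_def[symmetric] by auto
  qed
  show ?thesis using ex uniq by blast
qed

end
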